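(* Let $g$ be a probability density function on $(0,\infty)$ and let $f_M$ be the variance mixture of $N(0,\sigma^2)$-densities $$f_M(x)=\int_0^\infty\frac{1}{\sqrt{2\pi y}}e^{-\frac{x^2}{2y}}g(y)\,dy,\quad x\in\mathbb{R}.$$ Assume that $g(x)=x^{-3/2}g(1/x)$ for all $x>0$ and that the moments of $g$ are finite for all orders. Let $\psi_M(x)=\sum_{n=1}^\infty\hat f_M(\sqrt{2\pi}\,xn)$ for $x>0$. Then the Mellin transform $\eta_M(s)$ of $\psi_M$ satisfies, for $s>1$, $$\eta_M(s)\equiv\int_0^\infty x^{s-1}\psi_M(x)\,dx=\frac12\pi^{-s/2}\Gamma\left(\frac s2\right)\zeta(s)\int_0^\infty x^{\frac{s-1}{2}}g(x)\,dx,$$ and the function $\xi_2(s)\equiv s(s-1)\eta_M(s)$ (for $s>1$) is equal to a product of two entire functions, namely $$\xi_2(s)=\xi_0(s)\,\xi_1(s),\quad s\in\mathbb{C},$$ where $$\xi_0(s)=\frac12 s(s-1)\pi^{-s/2}\Gamma\left(\frac s2\right)\zeta(s)\qquad\text{and}\qquad \xi_1(s)\equiv\int_0^\infty x^{\frac{s-1}{2}}g(x)\,dx\quad(s>1).$$ Furthermore, all three functions $\xi_i(s)$, $i=0,1,2$, are entire functions of $s$ and satisfy the functional equation $\xi_i(s)=\xi_i(1-s)$.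
   Context: For a probability density function $f$ on $\mathbb{R}$, $\hat f(t)=\int_{\mathbb{R}}e^{itx}f(x)\,dx$ denotes its characteristic function. $\zeta$ is the Riemann zeta function. Functions given by a formula for $s>1$ are identified with their analytic continuation; saying that such a function is entire means that it extends to an entire function, and identities for $s\in\mathbb{C}$ refer to the extensions. *)

theory Defs
  imports "HOL-Complex_Analysis.Complex_Analysis"
begin

definition pdf_on_pos :: "(real \<Rightarrow> real) \<Rightarrow> bool" where
  "pdf_on_pos g \<longleftrightarrow>
     (\<forall>x>0. 0 \<le> g x) \<and> set_integrable lborel {0<..} g \<and> (LBINT x:{0<..}. g x) = 1"

definition char_fun :: "(real \<Rightarrow> real) \<Rightarrow> real \<Rightarrow> complex" where
  "char_fun f t = (LINT x|lborel. exp (\<i> * of_real (t * x)) * complex_of_real (f x))"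

definition variance_mixture :: "(real \<Rightarrow> real) \<Rightarrow> real \<Rightarrow> real" where
  "variance_mixture g x =
     (LBINT y:{0<..}. 1 / sqrt (2 * pi * y) * exp (- (x\<^sup>2 / (2 * y))) * g y)"

text \<open>The summation index of the library's series starts at 0, whence the shift by \<open>Suc\<close>.\<close>

definition psi_term :: "(real \<Rightarrow> real) \<Rightarrow> real \<Rightarrow> nat \<Rightarrow> complex" where
  "psi_term g x n = char_fun (variance_mixture g) (sqrt (2 * pi) * x * real (Suc n))"

definition psi_M :: "(real \<Rightarrow> real) \<Rightarrow> real \<Rightarrow> complex" where
  "psi_M g x = (\<Sum>n. psi_term g x n)"

definition mellin_integrable :: "(real \<Rightarrow> complex) \<Rightarrow> complex \<Rightarrow> bool" where
  "mellin_integrable h s \<longleftrightarrow>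
     set_integrable lborel {0<..} (\<lambda>x. complex_of_real x powr (s - 1) * h x)"

definition mellin :: "(real \<Rightarrow> complex) \<Rightarrow> complex \<Rightarrow> complex" where
  "mellin h s = (LBINT x:{0<..}. complex_of_real x powr (s - 1) * h x)"

text \<open>
  The Riemann zeta function is the analytic continuation of the Dirichlet series to the plane
  without 1. By the identity theorem this fixes all values except the one at the pole 1,
  which is left unspecified.
\<close>

definition zeta :: "complex \<Rightarrow> complex" where
  "zeta = (SOME Z. Z holomorphic_on (- {1}) \<and>
             (\<forall>s. Re s > 1 \<longrightarrow> Z s = (\<Sum>n. 1 / of_nat (Suc n) powr s)))"

text \<open>
  \<open>entire_extension A f F\<close>: the function \<open>f\<close>, given by a formula that is meaningful on \<open>A\<close>,
  extends to the entire function \<open>F\<close>. If \<open>A\<close> has a limit point, \<open>F\<close> is uniquely determined.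
\<close>

definition entire_extension ::
    "complex set \<Rightarrow> (complex \<Rightarrow> complex) \<Rightarrow> (complex \<Rightarrow> complex) \<Rightarrow> bool" where
  "entire_extension A f F \<longleftrightarrow> F holomorphic_on UNIV \<and> (\<forall>s\<in>A. F s = f s)"

end

theory Submission
  imports Defs "HOL-Probability.Probability"
begin

text \<open>
  The characteristic function of the mixture at \<open>t\<close> is the integral of \<open>exp (- t\<^sup>2 * y / 2)\<close> against
  \<open>g y\<close>. Hence \<open>psi_M g\<close> is a mixture of rescaled theta tails
  \<open>theta_tail r = (\<Sum>n\<ge>1. exp (- pi * n\<^sup>2 * r\<^sup>2))\<close>: the scale belonging to the variance \<open>y\<close> is
  \<open>sqrt y\<close> (\<open>psi_M_eq_theta_mixture\<close>). A change of scale acts on Mellin transforms by multiplication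
  with a power, so the Mellin transform of \<open>psi_M g\<close> factors into that of \<open>theta_tail\<close> and a moment
  of \<open>g\<close> (\<open>mellin_psi_M\<close>). The first factor is \<open>pi powr (- s / 2) * Gamma (s / 2) * zeta s / 2\<close>,
  so the theorem reduces to two independent facts.

  The moment function of \<open>g\<close> is entire and symmetric. The condition
  \<open>g x = x powr (- 3 / 2) * g (1 / x)\<close> says that the substitution \<open>x \<mapsto> 1 / x\<close> reflects moments,
  exchanging the orders \<open>(s - 1) / 2\<close> and \<open>- s / 2\<close>. It therefore turns finiteness of the
  positive moments into finiteness of all real moments (\<open>mixing_density_powr_integrable\<close>), and a
  function with all real moments has an entire moment function (\<open>holomorphic_power_integral\<close>).

  The completed zeta function is entire and symmetric. This is Riemann's theorem, proved here in
  his way from the inversion formula of the theta function: \<open>riemann_xi\<close> is manifestly entire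
  and symmetric, and folding the Mellin integral of \<open>theta_tail\<close> at 1 identifies it with the
  completed zeta function (\<open>theta_tail_mellin_eq_riemann_xi\<close>, \<open>riemann_xi_eq_completed_zeta\<close>).
  In particular this yields the continuation of the Dirichlet series on which the definition of
  \<open>zeta\<close> rests (\<open>zeta_props\<close>).

  The inversion formula \<open>theta_inversion\<close> is Poisson summation for a Gaussian. It needs a Fourier
  series only at one point and only for a holomorphic function, and for these convergence has a
  short proof by a telescoping sum (\<open>fourier_partial_sums_tendsto\<close>).
\<close>

section \<open>Integrals of powers over the half-line\<close>

lemma set_integrable_lborel_iff_absolutely_integrable:
  fixes f :: "real \<Rightarrow> 'a::euclidean_space"
  assumes "set_borel_measurable borel A f"
  shows "set_integrable lborel A f \<longleftrightarrow> f absolutely_integrable_on A"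
  using assms unfolding set_integrable_def set_borel_measurable_def
  by (intro integrable_completion[symmetric]) simp

text \<open>
  The library's change of variables is stated for absolute gauge integrability. On Borel
  functions that notion agrees with integrability over \<open>lborel\<close>, and where integrability
  fails both Bochner integrals have the default value 0, so the integrals agree in every case.
\<close>

lemma lborel_change_of_variables:
  fixes f :: "real \<Rightarrow> 'a::euclidean_space" and \<phi> \<phi>' :: "real \<Rightarrow> real"
  assumes sets: "A \<in> sets borel" "\<phi> ` A \<in> sets borel"
    and deriv: "\<And>x. x \<in> A \<Longrightarrow> (\<phi> has_field_derivative \<phi>' x) (at x within A)"
    and inj: "inj_on \<phi> A"
    and meas: "set_borel_measurable borel A (\<lambda>x. \<bar>\<phi>' x\<bar> *\<^sub>R f (\<phi> x))"
              "set_borel_measurable borel (\<phi> ` A) f"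
  shows "set_integrable lborel A (\<lambda>x. \<bar>\<phi>' x\<bar> *\<^sub>R f (\<phi> x)) \<longleftrightarrow> set_integrable lborel (\<phi> ` A) f" (is ?int)
    and "(LBINT x:A. \<bar>\<phi>' x\<bar> *\<^sub>R f (\<phi> x)) = (LBINT y:\<phi> ` A. f y)" (is ?eq)
proof -
  note leb = set_integrable_lborel_iff_absolutely_integrable
  have A: "A \<in> sets lebesgue"
    using sets(1) by (simp add: sets_completionI_sets)
  note cov = has_absolute_integral_change_of_variables_real[OF A deriv inj]
  show int: ?int
    using cov leb[OF meas(1)] leb[OF meas(2)] by metis
  show ?eq
  proof (cases "set_integrable lborel (\<phi> ` A) f")
    case True
    with int have int': "set_integrable lborel A (\<lambda>x. \<bar>\<phi>' x\<bar> *\<^sub>R f (\<phi> x))"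
      by blast
    have "integral A (\<lambda>x. \<bar>\<phi>' x\<bar> *\<^sub>R f (\<phi> x)) = integral (\<phi> ` A) f"
      using cov leb[OF meas(2)] True by metis
    then show ?thesis
      using set_borel_integral_eq_integral(2)[OF True] set_borel_integral_eq_integral(2)[OF int']
      by simp
  next
    case False
    then show ?thesis
      using int by (simp add: set_integrable_def set_lebesgue_integral_def not_integrable_integral_eq)
  qed
qed

lemma lborel_inversion:
  fixes f :: "real \<Rightarrow> 'a::euclidean_space"
  assumes A: "A \<in> sets borel" "B \<in> sets borel" "A \<subseteq> {0<..}" "(\<lambda>x. 1 / x) ` A = B"
    and f: "set_borel_measurable borel B f"
  shows "set_integrable lborel A (\<lambda>x. (1 / x\<^sup>2) *\<^sub>R f (1 / x)) \<longleftrightarrow> set_integrable lborel B f" (is ?int)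
    and "(LBINT x:A. (1 / x\<^sup>2) *\<^sub>R f (1 / x)) = (LBINT y:B. f y)" (is ?eq)
proof -
  have f': "(\<lambda>x. indicator B x *\<^sub>R f x) \<in> borel_measurable borel"
    using f by (simp add: set_borel_measurable_def)
  have "(\<lambda>x. indicator B (1/x) *\<^sub>R f (1/x)) \<in> borel_measurable borel"
    by (rule measurable_compose[OF _ f', of "\<lambda>x. 1 / x"]) simp
  then have "(\<lambda>x. (indicator A x / x\<^sup>2) *\<^sub>R (indicator B (1/x) *\<^sub>R f (1/x))) \<in> borel_measurable borel"
    by (rule borel_measurable_scaleR[rotated]) (use A(1) in measurable)
  also have "(\<lambda>x. (indicator A x / x\<^sup>2) *\<^sub>R (indicator B (1/x) *\<^sub>R f (1/x))) =
      (\<lambda>x. indicator A x *\<^sub>R ((1 / x\<^sup>2) *\<^sub>R f (1/x)))"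
    using A(4) by (auto split: split_indicator simp: fun_eq_iff)
  finally have m: "set_borel_measurable borel A (\<lambda>x. \<bar>- (1 / x\<^sup>2)\<bar> *\<^sub>R f (1 / x))"
    by (simp add: set_borel_measurable_def)
  have d: "((\<lambda>x. 1 / x) has_field_derivative - (1 / x\<^sup>2)) (at x within A)" if "x \<in> A" for x :: real
  proof -
    have "x \<noteq> 0" using that A by auto
    then show ?thesis
      by (auto intro!: derivative_eq_intros simp: power2_eq_square)
  qed
  have inj: "inj_on (\<lambda>x. 1 / x) A" by (auto simp: inj_on_def)
  have B: "(\<lambda>x. 1 / x) ` A \<in> sets borel" using A by simp
  have f'': "set_borel_measurable borel ((\<lambda>x. 1 / x) ` A) f" using A f by simp
  note c = lborel_change_of_variables[OF A(1) B d inj m f'', unfolded A(4)]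
  show ?int ?eq using c by simp_all
qed

lemma image_inverse_greaterThan: "(\<lambda>x. 1 / x) ` {0<..} = {0::real<..}"
  by (auto simp: image_iff intro!: bexI[of _ "1 / _"])

lemma image_inverse_greaterThan_1: "(\<lambda>x. 1 / x) ` {1<..} = {0<..<1::real}"
proof (intro equalityI subsetI)
  fix y :: real assume "y \<in> {0<..<1}"
  then show "y \<in> (\<lambda>x. 1 / x) ` {1<..}"
    by (intro image_eqI[of _ _ "1 / y"]) (auto simp: field_simps)
qed (auto simp: field_simps)

text \<open>
  The factor \<open>x powr (s - Re s)\<close> has modulus 1 and is measurable, so a complex exponent costs
  no more than its real part.
\<close>

lemma set_integrable_powr_complex:
  fixes h :: "real \<Rightarrow> real" and s :: complex
  assumes A: "A \<in> sets borel" "A \<subseteq> {0<..}"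
    and int: "set_integrable lborel A (\<lambda>x. x powr Re s * h x)"
  shows "set_integrable lborel A (\<lambda>x. of_real x powr s * of_real (h x))"
proof -
  have *: "of_real x powr (s - of_real (Re s)) * of_real (x powr Re s) = complex_of_real x powr s"
    if "x > 0" for x
    using that by (simp add: powr_diff powr_of_real)
  have m: "(\<lambda>x. indicator A x *\<^sub>R (x powr Re s * h x)) \<in> borel_measurable lborel"
    using int unfolding set_integrable_def by (rule borel_measurable_integrable)
  have "(\<lambda>x. complex_of_real x powr (s - of_real (Re s)) * of_real (indicator A x *\<^sub>R (x powr Re s * h x)))
        \<in> borel_measurable lborel"
    using m by measurable
  also have "(\<lambda>x. complex_of_real x powr (s - of_real (Re s)) * of_real (indicator A x *\<^sub>R (x powr Re s * h x)))
     = (\<lambda>x. indicator A x *\<^sub>R (of_real x powr s * of_real (h x)))"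
    using A(2) by (auto simp: fun_eq_iff * split: split_indicator)
  finally have m': "(\<lambda>x. indicator A x *\<^sub>R (of_real x powr s * of_real (h x))) \<in> borel_measurable lborel" .
  show ?thesis
    unfolding set_integrable_def
  proof (rule Bochner_Integration.integrable_bound[OF int[unfolded set_integrable_def] m'])
    show "AE x in lborel. norm (indicator A x *\<^sub>R (complex_of_real x powr s * of_real (h x)))
          \<le> norm (indicator A x *\<^sub>R (x powr Re s * h x))"
      using A(2) by (auto intro!: AE_I2 simp: norm_mult norm_powr_real_powr abs_mult split: split_indicator)
  qed
qed

text \<open>
  With \<open>L = ln x\<close> the difference is \<open>x powr s * (exp (w * L) - 1)\<close>, and for \<open>\<bar>w\<bar> \<le> 1\<close> the second
  factor is at most \<open>\<bar>w\<bar> * \<bar>L\<bar> * exp \<bar>L\<bar> \<le> \<bar>w\<bar> * exp (2 * \<bar>L\<bar>)\<close>. Bounding \<open>exp (2 * \<bar>L\<bar>)\<close> by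
  \<open>x powr 2 + x powr (-2)\<close> removes the logarithm, so the bound consists of powers of \<open>x\<close> only.
\<close>

lemma norm_powr_diff_quotient_le:
  fixes x :: real and s w :: complex
  assumes x: "x > 0" and w: "norm w \<le> 1"
  shows "norm (of_real x powr (s + w) - of_real x powr s) \<le>
           norm w * (x powr (Re s + 2) + x powr (Re s - 2))"
proof -
  define L where "L = ln x"
  have 1: "of_real x powr (s + w) - of_real x powr s = of_real x powr s * (exp (w * of_real L) - 1)"
    using x by (simp add: powr_add algebra_simps L_def) (simp add: powr_def Ln_of_real)
  have "norm (exp (w * of_real L) - 1) \<le> exp \<bar>Re (w * of_real L)\<bar> * norm (w * of_real L)"
    using Taylor_exp[of "w * of_real L" 0] by simp
  also have "\<dots> \<le> exp \<bar>L\<bar> * (norm w * exp \<bar>L\<bar>)"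
  proof (intro mult_mono)
    have "\<bar>Re w\<bar> \<le> 1" using abs_Re_le_cmod[of w] w by simp
    then show "exp \<bar>Re (w * of_real L)\<bar> \<le> exp \<bar>L\<bar>"
      by (simp add: abs_mult mult_left_le_one_le)
    have "\<bar>L\<bar> \<le> exp \<bar>L\<bar>" using exp_ge_add_one_self[of "\<bar>L\<bar>"] by linarith
    then show "norm (w * of_real L) \<le> norm w * exp \<bar>L\<bar>"
      by (simp add: norm_mult mult_left_mono)
  qed auto
  also have "\<dots> = norm w * exp (2 * \<bar>L\<bar>)"
    by (simp add: exp_add[symmetric] mult_ac)
  also have "\<dots> \<le> norm w * (x powr 2 + x powr (- 2))"
    using x unfolding L_def by (intro mult_left_mono) (auto simp: powr_def abs_if simp del: powr_numeral)
  finally have "norm (of_real x powr (s + w) - of_real x powr s) \<le>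
       x powr Re s * (norm w * (x powr 2 + x powr (- 2)))"
    unfolding 1 using x by (simp add: norm_mult norm_powr_real_powr mult_left_mono)
  also have "\<dots> = norm w * (x powr (Re s + 2) + x powr (Re s - 2))"
    using x by (simp add: powr_add powr_diff powr_minus divide_inverse algebra_simps)
  finally show ?thesis .
qed

text \<open>
  If \<open>h\<close> is integrable against every real power, then the integral may be differentiated under
  the integral sign at every point: the difference quotients are dominated by the integrable
  function \<open>(x powr (Re s + 2) + x powr (Re s - 2)) * \<bar>h x\<bar>\<close>.
\<close>

lemma holomorphic_power_integral:
  fixes h :: "real \<Rightarrow> real"
  assumes A: "A \<in> sets borel" "A \<subseteq> {0<..}"
    and int: "\<And>a::real. set_integrable lborel A (\<lambda>x. x powr a * h x)"
  shows "(\<lambda>s. LBINT x:A. of_real x powr s * of_real (h x)) holomorphic_on UNIV"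
proof -
  let ?F = "\<lambda>s. LBINT x:A. complex_of_real x powr s * of_real (h x)"
  have intc: "set_integrable lborel A (\<lambda>x. complex_of_real x powr s * of_real (h x))" for s
    by (rule set_integrable_powr_complex[OF A int])
  have "(?F has_field_derivative (LBINT x:A. of_real (ln x) * (of_real x powr s * of_real (h x)))) (at s)" for s
    unfolding has_field_derivative_iff tendsto_at_iff_sequentially
  proof (intro allI impI)
    fix X :: "nat \<Rightarrow> complex"
    assume X: "\<forall>i. X i \<in> UNIV - {s}" and lim: "X \<longlonglongrightarrow> s"
    define b where "b = (\<lambda>x. x powr (Re s + 2) * h x + x powr (Re s - 2) * h x)"
    \<comment> \<open>The domination needs increments of modulus at most 1, hence the shift by \<open>N\<close>.\<close>
    obtain N where N: "norm (X (n + N) - s) \<le> 1" for n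
      using lim unfolding lim_sequentially dist_norm by (meson le_add2 less_imp_le zero_less_one)
    define Q where "Q = (\<lambda>n x. (complex_of_real x powr X n - of_real x powr s) / (X n - s) * of_real (h x))"
    have Qi: "set_integrable lborel A (Q n)" for n
      unfolding Q_def diff_divide_distrib left_diff_distrib times_divide_eq_left
      by (intro set_integral_diff set_integrable_divide intc)
    have Qeq: "(?F (X n) - ?F s) / (X n - s) = (LBINT x:A. Q n x)" for n
      unfolding Q_def times_divide_eq_left left_diff_distrib
      by (simp add: set_integral_diff intc set_integral_divide_zero)
    have "(\<lambda>n. LBINT x:A. Q (n + N) x) \<longlonglongrightarrow> (LBINT x:A. of_real (ln x) * (of_real x powr s * of_real (h x)))"
      unfolding set_lebesgue_integral_def
    proof (rule integral_dominated_convergence[where w = "\<lambda>x. indicator A x *\<^sub>R \<bar>b x\<bar>"])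
      show 1: "(\<lambda>x. indicator A x *\<^sub>R Q (n + N) x) \<in> borel_measurable lborel" for n
        using Qi unfolding set_integrable_def by (rule borel_measurable_integrable)
      have "set_integrable lborel A b"
        unfolding b_def by (intro set_integral_add int)
      then show "integrable lborel (\<lambda>x. indicator A x *\<^sub>R \<bar>b x\<bar>)"
        using set_integrable_abs unfolding set_integrable_def by blast
      show "AE x in lborel. norm (indicator A x *\<^sub>R Q (n + N) x) \<le> indicator A x *\<^sub>R \<bar>b x\<bar>" for n
      proof (rule AE_I2)
        fix x :: real
        show "norm (indicator A x *\<^sub>R Q (n + N) x) \<le> indicator A x *\<^sub>R \<bar>b x\<bar>"
        proof (cases "x \<in> A")
          case True
          then have x: "x > 0" using A by auto
          have ne: "norm (X (n + N) - s) > 0" using X by simp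
          have "norm (of_real x powr X (n + N) - of_real x powr s) \<le>
             norm (X (n + N) - s) * (x powr (Re s + 2) + x powr (Re s - 2))"
            using norm_powr_diff_quotient_le[OF x N, of s n] by simp
          then have "norm (of_real x powr X (n + N) - of_real x powr s) / norm (X (n + N) - s) \<le>
              x powr (Re s + 2) + x powr (Re s - 2)"
            using ne by (simp add: field_simps)
          then have "norm (Q (n + N) x) \<le> (x powr (Re s + 2) + x powr (Re s - 2)) * \<bar>h x\<bar>"
            using mult_right_mono[of _ _ "\<bar>h x\<bar>"] unfolding Q_def by (fastforce simp: norm_mult norm_divide)
          also have "\<dots> = \<bar>b x\<bar>"
            unfolding b_def distrib_right[symmetric] by (simp add: abs_mult)
          finally show ?thesis using True by simp
        qed simp
      qed
      show lim': "AE x in lborel. (\<lambda>n. indicator A x *\<^sub>R Q (n + N) x) \<longlonglongrightarrow>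
          indicator A x *\<^sub>R (of_real (ln x) * (of_real x powr s * of_real (h x)))"
      proof (rule AE_I2)
        fix x :: real
        show "(\<lambda>n. indicator A x *\<^sub>R Q (n + N) x) \<longlonglongrightarrow>
          indicator A x *\<^sub>R (of_real (ln x) * (of_real x powr s * of_real (h x)))"
        proof (cases "x \<in> A")
          case True
          then have x: "x > 0" using A by auto
          have "((\<lambda>z. of_real x powr z) has_field_derivative of_real (ln x) * of_real x powr s) (at s)"
            using x by (auto intro!: derivative_eq_intros simp: Ln_of_real)
          then have "(\<lambda>n. (complex_of_real x powr X n - of_real x powr s) / (X n - s)) \<longlonglongrightarrow>
               of_real (ln x) * of_real x powr s"
            using X lim unfolding has_field_derivative_iff tendsto_at_iff_sequentially comp_def by auto
          then have "(\<lambda>n. Q n x) \<longlonglongrightarrow> of_real (ln x) * (of_real x powr s * of_real (h x))"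
            unfolding Q_def mult.assoc[symmetric] by (intro tendsto_intros)
          then show ?thesis using True LIMSEQ_ignore_initial_segment[of "\<lambda>n. Q n x" _ N] by simp
        qed simp
      qed
      show "(\<lambda>x. indicator A x *\<^sub>R (of_real (ln x) * (of_real x powr s * of_real (h x)))) \<in> borel_measurable lborel"
      proof -
        have "(\<lambda>x. of_real (ln x) * (indicator A x *\<^sub>R (complex_of_real x powr s * of_real (h x)))) \<in> borel_measurable lborel"
          by (intro borel_measurable_times borel_measurable_integrable[OF intc[unfolded set_integrable_def]]) auto
        then show ?thesis by (simp add: mult.left_commute scaleR_conv_of_real)
      qed
    qed
    then have "(\<lambda>n. LBINT x:A. Q n x) \<longlonglongrightarrow> (LBINT x:A. of_real (ln x) * (of_real x powr s * of_real (h x)))"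
      by (rule LIMSEQ_offset)
    then show "((\<lambda>y. (?F y - ?F s) / (y - s)) \<circ> X) \<longlonglongrightarrow>
        (LBINT x:A. of_real (ln x) * (of_real x powr s * of_real (h x)))"
      by (simp add: comp_def Qeq)
  qed
  then show ?thesis
    by (auto simp: holomorphic_on_def field_differentiable_def)
qed

section \<open>Fourier series of holomorphic functions at the origin\<close>

text \<open>
  The period interval is centred at 0 so that it lies in the open unit disc, where
  \<open>exp (2 * pi * \<i> * z) = 1\<close> happens only at \<open>z = 0\<close>.
\<close>

definition fourier_coeff :: "(complex \<Rightarrow> complex) \<Rightarrow> int \<Rightarrow> complex" where
  "fourier_coeff f k =
     integral {-1/2..1/2} (\<lambda>t. f (of_real t) * exp (- (2 * of_real pi * \<i> * of_int k * of_real t)))"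

lemma of_real_in_unit_ball:
  "t \<in> {-1/2..1/2} \<Longrightarrow> complex_of_real t \<in> ball 0 1"
  by auto

lemma fourier_coeff_integrable:
  fixes f :: "complex \<Rightarrow> complex"
  assumes "continuous_on (ball 0 1) f"
  shows "(\<lambda>t. f (of_real t) * exp (- (2 * of_real pi * \<i> * of_int k * of_real t)))
           integrable_on {-1/2..1/2}"
proof -
  have "continuous_on {-1/2..1/2} (\<lambda>t. f (complex_of_real t))"
    using of_real_in_unit_ball
    by (intro continuous_on_compose2[OF assms]) (auto intro!: continuous_intros)
  then show ?thesis
    by (intro integrable_continuous_interval continuous_intros)
qed

lemma fourier_coeff_cong:
  assumes "\<And>z. z \<in> ball 0 1 \<Longrightarrow> f z = g z"
  shows "fourier_coeff f k = fourier_coeff g k"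
  unfolding fourier_coeff_def
  by (intro integral_cong) (use assms of_real_in_unit_ball in auto)

lemma fourier_coeff_diff:
  assumes "continuous_on (ball 0 1) f" "continuous_on (ball 0 1) g"
  shows "fourier_coeff (\<lambda>z. f z - g z) k = fourier_coeff f k - fourier_coeff g k"
  unfolding fourier_coeff_def left_diff_distrib
  by (intro integral_diff fourier_coeff_integrable assms)

lemma fourier_coeff_shift:
  "fourier_coeff (\<lambda>z. exp (2 * of_real pi * \<i> * z) * f z) k = fourier_coeff f (k - 1)"
  unfolding fourier_coeff_def
  by (intro integral_cong) (simp add: algebra_simps exp_diff exp_add exp_minus field_simps)

lemma exp_half_period:
  "exp (- (2 * of_real pi * \<i> * of_int k * (1/2))) = exp (- (2 * of_real pi * \<i> * of_int k * (-1/2)))"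
proof -
  have "exp (2 * of_real pi * \<i> * of_int k) = 1"
    unfolding exp_eq_1 by (auto intro!: exI[of _ k])
  moreover have "- (2 * of_real pi * \<i> * of_int k * (-1/2)) =
     - (2 * of_real pi * \<i> * of_int k * (1/2)) + 2 * of_real pi * \<i> * of_int k"
    by (simp add: field_simps)
  ultimately show ?thesis by (metis exp_add mult.right_neutral)
qed

text \<open>
  The boundary terms cancel because \<open>f\<close> and the exponential take equal values at the two ends of
  the period interval.
\<close>

lemma fourier_coeff_by_parts:
  assumes f: "f holomorphic_on ball 0 1" and per: "f (1/2) = f (-1/2)"
  shows "fourier_coeff (deriv f) k = 2 * of_real pi * \<i> * of_int k * fourier_coeff f k"
proof -
  let ?e = "\<lambda>t. exp (- (2 * of_real pi * \<i> * of_int k * t))"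
  have "((\<lambda>t. deriv f (of_real t) * ?e (of_real t) - 2 * of_real pi * \<i> * of_int k * (f (of_real t) * ?e (of_real t)))
     has_integral (f (of_real (1/2)) * ?e (of_real (1/2)) - f (of_real (-1/2)) * ?e (of_real (-1/2)))) {-1/2..1/2}"
  proof (rule fundamental_theorem_of_calculus)
    fix t :: real assume t: "t \<in> {-1/2..1/2}"
    have d: "(f has_field_derivative deriv f (of_real t)) (at (of_real t))"
      by (rule holomorphic_derivI[OF f]) (use of_real_in_unit_ball[OF t] in auto)
    have "((\<lambda>z. f z * ?e z) has_field_derivative
        (deriv f (of_real t) * ?e (of_real t) - 2 * of_real pi * \<i> * of_int k * (f (of_real t) * ?e (of_real t)))) (at (of_real t))"
      by (rule derivative_eq_intros d refl | simp)+
    then show "((\<lambda>t. f (of_real t) * ?e (of_real t)) has_vector_derivative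
       (deriv f (of_real t) * ?e (of_real t) - 2 * of_real pi * \<i> * of_int k * (f (of_real t) * ?e (of_real t)))) (at t within {-1/2..1/2})"
      by (rule has_vector_derivative_real_field)
  qed simp
  then have "((\<lambda>t. deriv f (of_real t) * ?e (of_real t) - 2 * of_real pi * \<i> * of_int k * (f (of_real t) * ?e (of_real t)))
     has_integral 0) {-1/2..1/2}"
    using exp_half_period[of k] per by simp
  then have "integral {-1/2..1/2} (\<lambda>t. deriv f (of_real t) * ?e (of_real t) - 2 * of_real pi * \<i> * of_int k * (f (of_real t) * ?e (of_real t))) = 0"
    by (rule integral_unique)
  moreover have "continuous_on (ball 0 1) f" "continuous_on (ball 0 1) (deriv f)"
    using f holomorphic_deriv[OF f] by (auto intro: holomorphic_on_imp_continuous_on)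
  ultimately show ?thesis
    unfolding fourier_coeff_def
    using integral_diff[OF fourier_coeff_integrable[of "deriv f" k]
        integrable_on_mult_right[OF fourier_coeff_integrable[of f k]], of "2 * of_real pi * \<i> * of_int k"]
    by simp
qed

lemma fourier_coeff_const:
  "fourier_coeff (\<lambda>_. c) k = (if k = 0 then c else 0)"
proof (cases "k = 0")
  case False
  have "fourier_coeff (deriv (\<lambda>_. c)) k = 2 * of_real pi * \<i> * of_int k * fourier_coeff (\<lambda>_. c) k"
    by (rule fourier_coeff_by_parts) auto
  then show ?thesis using False by (simp add: fourier_coeff_def)
qed (simp add: fourier_coeff_def)

lemma norm_fourier_coeff_le:
  assumes f: "continuous_on (ball 0 1) f"
  obtains B where "\<And>k. norm (fourier_coeff f k) \<le> B"
proof
  fix k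
  have "continuous_on {-1/2..1/2} (\<lambda>t. f (complex_of_real t))"
    using of_real_in_unit_ball
    by (intro continuous_on_compose2[OF f]) (auto intro!: continuous_intros)
  then have "(\<lambda>t. norm (f (complex_of_real t))) integrable_on {-1/2..1/2}"
    by (intro integrable_continuous_interval continuous_intros)
  then show "norm (fourier_coeff f k) \<le> integral {-1/2..1/2} (\<lambda>t. norm (f (complex_of_real t)))"
    unfolding fourier_coeff_def
    by (intro integral_norm_bound_integral fourier_coeff_integrable f) (auto simp: norm_mult)
qed

text \<open>
  For holomorphic \<open>f\<close> the Riemann-Lebesgue lemma is one integration by parts: the coefficients
  of \<open>deriv f\<close> are bounded, so those of \<open>f\<close> are \<open>O(1 / \<bar>k\<bar>)\<close>.
\<close>

lemma fourier_coeff_tendsto_0: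
  assumes f: "f holomorphic_on ball 0 1" and per: "f (1/2) = f (-1/2)"
    and k: "filterlim (\<lambda>n. \<bar>k n\<bar>) at_top sequentially"
  shows "(\<lambda>n. fourier_coeff f (k n)) \<longlonglongrightarrow> 0"
proof -
  have "continuous_on (ball 0 1) (deriv f)"
    using holomorphic_deriv[OF f] by (auto intro: holomorphic_on_imp_continuous_on)
  then obtain B where B: "\<And>k. norm (fourier_coeff (deriv f) k) \<le> B"
    using norm_fourier_coeff_le by blast
  have "filterlim (\<lambda>n. real_of_int \<bar>k n\<bar>) at_top sequentially"
    by (rule filterlim_compose[OF filterlim_real_of_int_at_top k])
  then have "filterlim (\<lambda>n. 2 * pi * real_of_int \<bar>k n\<bar>) at_top sequentially"
    by (intro filterlim_tendsto_pos_mult_at_top[OF tendsto_const]) auto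
  then have lim: "(\<lambda>n. B / (2 * pi * real_of_int \<bar>k n\<bar>)) \<longlonglongrightarrow> 0"
    by (intro real_tendsto_divide_at_top[OF tendsto_const])
  have "eventually (\<lambda>n. \<bar>k n\<bar> \<ge> 1) sequentially"
    using k by (simp add: filterlim_at_top)
  then have "eventually (\<lambda>n. norm (fourier_coeff f (k n)) \<le> B / (2 * pi * real_of_int \<bar>k n\<bar>)) sequentially"
  proof eventually_elim
    case (elim n)
    have "norm (fourier_coeff (deriv f) (k n)) = 2 * pi * real_of_int \<bar>k n\<bar> * norm (fourier_coeff f (k n))"
      by (simp add: fourier_coeff_by_parts[OF f per] norm_mult)
    with B[of "k n"] elim show ?case
      by (simp add: field_simps)
  qed
  then show ?thesis
    using lim by (rule Lim_null_comparison)
qed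

text \<open>
  Chernoff's proof of pointwise convergence. Write \<open>e z = exp (2 * pi * \<i> * z)\<close>. In the unit disc
  \<open>e z - 1\<close> has a single, simple zero at 0, so \<open>h z - h 0 = (e z - 1) * q z\<close> with \<open>q\<close> holomorphic.
  Multiplication by \<open>e\<close> shifts Fourier coefficients, so the coefficients of \<open>h - h 0\<close> are
  differences of consecutive coefficients of \<open>q\<close>. Their symmetric partial sums telescope to two
  coefficients of \<open>q\<close> with large index, which tend to 0.
\<close>

lemma fourier_partial_sums_tendsto:
  assumes h: "h holomorphic_on ball 0 1" and per: "h (1/2) = h (-1/2)"
  shows "(\<lambda>K. \<Sum>k\<in>{-int K..int K}. fourier_coeff h k) \<longlonglongrightarrow> h 0"
proof -
  define e where "e = (\<lambda>z. exp (2 * of_real pi * \<i> * z))"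
  define H where "H = (\<lambda>z. if z = 0 then deriv h 0 else (h z - h 0) / (z - 0))"
  define E where "E = (\<lambda>z. if z = 0 then deriv e 0 else (e z - e 0) / (z - 0))"
  define q where "q = (\<lambda>z. H z / E z)"
  have e: "e holomorphic_on ball 0 1"
    unfolding e_def by (intro holomorphic_intros)
  have H: "H holomorphic_on ball 0 1" and E: "E holomorphic_on ball 0 1"
    unfolding H_def E_def by (intro pole_lemma_open h e; simp)+
  have "(e has_field_derivative 2 * of_real pi * \<i>) (at 0)"
    unfolding e_def by (auto intro!: derivative_eq_intros)
  then have de: "deriv e 0 = 2 * of_real pi * \<i>"
    by (rule DERIV_imp_deriv)
  have e1: "e z \<noteq> 1" if "z \<in> ball 0 1" "z \<noteq> 0" for z
  proof
    assume "e z = 1"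
    then obtain n :: int where n: "Im z = 0" "2 * pi * Re z = of_int (2 * n) * pi"
      unfolding e_def exp_eq_1 by auto
    then have "Re z = of_int n" by simp
    with n(1) have "z = of_int n" by (simp add: complex_eq_iff)
    moreover have "\<bar>Re z\<bar> < 1" using that(1) abs_Re_le_cmod[of z] by simp
    ultimately show False using that(2) by simp
  qed
  have E0: "E z \<noteq> 0" if "z \<in> ball 0 1" for z
    using e1[OF that] de by (auto simp: E_def e_def)
  have q: "q holomorphic_on ball 0 1"
    unfolding q_def by (intro holomorphic_intros H E E0)
  have hq: "h z - h 0 = e z * q z - q z" if "z \<in> ball 0 1" for z
    using e1[OF that] unfolding q_def H_def E_def by (auto simp: e_def field_simps)
  have e_half: "e (1/2) = -1" "e (-1/2) = -1"
    by (simp_all add: e_def exp_minus)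
  \<comment> \<open>Since \<open>e - 1\<close> equals \<open>-2\<close> at both ends of the period, \<open>q\<close> inherits the periodicity of \<open>h\<close>.\<close>
  have "e (1/2) * q (1/2) - q (1/2) = e (-1/2) * q (-1/2) - q (-1/2)"
    using hq[of "1/2"] hq[of "-1/2"] per by simp
  then have qper: "q (1/2) = q (-1/2)"
    unfolding e_half by simp
  note cont = holomorphic_on_imp_continuous_on
  have coeff: "fourier_coeff h k - (if k = 0 then h 0 else 0) = fourier_coeff q (k - 1) - fourier_coeff q k" for k
  proof -
    have "fourier_coeff h k - (if k = 0 then h 0 else 0) = fourier_coeff (\<lambda>z. h z - h 0) k"
      using fourier_coeff_diff[of h "\<lambda>_. h 0" k] cont[OF h] by (simp add: fourier_coeff_const)
    also have "\<dots> = fourier_coeff (\<lambda>z. e z * q z - q z) k"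
      using hq by (rule fourier_coeff_cong)
    also have "\<dots> = fourier_coeff q (k - 1) - fourier_coeff q k"
      using fourier_coeff_shift[of q k] e q
      by (subst fourier_coeff_diff) (auto intro!: cont holomorphic_intros simp: e_def)
    finally show ?thesis .
  qed
  have tele: "(\<Sum>k\<in>{-int K..int K}. fourier_coeff q (k - 1) - fourier_coeff q k) =
       fourier_coeff q (- int K - 1) - fourier_coeff q (int K)" for K
  proof (induction K)
    case (Suc K)
    have "{-int (Suc K)..int (Suc K)} = insert (int K + 1) (insert (-int K - 1) {-int K..int K})"
      by auto
    then show ?case using Suc by (simp add: algebra_simps)
  qed simp
  have sum: "(\<Sum>k\<in>{-int K..int K}. fourier_coeff h k) =
       h 0 + (fourier_coeff q (- int K - 1) - fourier_coeff q (int K))" for K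
  proof -
    have "(\<Sum>k\<in>{-int K..int K}. fourier_coeff h k) =
       (\<Sum>k\<in>{-int K..int K}. (if k = 0 then h 0 else 0) + (fourier_coeff q (k - 1) - fourier_coeff q k))"
      by (intro sum.cong refl) (simp flip: coeff)
    then show ?thesis by (simp add: sum.distrib tele)
  qed
  have l1: "filterlim (\<lambda>K. \<bar>int K\<bar>) at_top sequentially"
    by (simp add: filterlim_int_sequentially)
  have l2: "filterlim (\<lambda>K. \<bar>- int K - 1\<bar>) at_top sequentially"
    by (rule filterlim_at_top_mono[OF filterlim_int_sequentially]) simp
  have "(\<lambda>K. h 0 + (fourier_coeff q (- int K - 1) - fourier_coeff q (int K))) \<longlonglongrightarrow> h 0 + (0 - 0)"
    by (intro tendsto_intros fourier_coeff_tendsto_0[OF q qper l1] fourier_coeff_tendsto_0[OF q qper l2])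
  then show ?thesis by (simp add: sum)
qed

text \<open>
  This is the characteristic function of the standard normal distribution, rescaled by the
  standard deviation \<open>sqrt v\<close>.
\<close>

lemma gaussian_fourier:
  fixes t v :: real
  assumes v: "v > 0"
  shows "(LINT x|lborel. exp (\<i> * of_real (t * x)) * complex_of_real (normal_density 0 (sqrt v) x)) =
            of_real (exp (- (v * t\<^sup>2 / 2)))"
proof -
  have "(LINT x|lborel. exp (\<i> * of_real (t * x)) * complex_of_real (normal_density 0 (sqrt v) x)) =
      sqrt v *\<^sub>R (LINT x|lborel. exp (\<i> * of_real (t * (0 + sqrt v * x))) *
          complex_of_real (normal_density 0 (sqrt v) (0 + sqrt v * x)))"
    using v lborel_integral_real_affine[of "sqrt v"
       "\<lambda>x. exp (\<i> * of_real (t * x)) * complex_of_real (normal_density 0 (sqrt v) x)" 0] by simp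
  also have "\<dots> = (LINT x|lborel. std_normal_density x *\<^sub>R exp (\<i> * of_real ((t * sqrt v) * x)))"
  proof (subst integral_scaleR_right[symmetric], rule Bochner_Integration.integral_cong)
    fix x :: real
    have "sqrt v * normal_density 0 (sqrt v) (sqrt v * x) = std_normal_density x"
      using v by (simp add: normal_density_def real_sqrt_mult power_mult_distrib field_simps)
    then show "sqrt v *\<^sub>R (exp (\<i> * of_real (t * (0 + sqrt v * x))) *
          complex_of_real (normal_density 0 (sqrt v) (0 + sqrt v * x))) =
          std_normal_density x *\<^sub>R exp (\<i> * of_real ((t * sqrt v) * x))"
      by (simp add: scaleR_conv_of_real mult.assoc mult.left_commute flip: of_real_mult)
  qed simp
  also have "\<dots> = char std_normal_distribution (t * sqrt v)"
    unfolding char_def by (subst integral_density) auto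
  also have "\<dots> = of_real (exp (- (v * t\<^sup>2 / 2)))"
    using v by (simp add: char_std_normal_distribution power_mult_distrib mult.commute)
  finally show ?thesis .
qed

section \<open>Inversion of the theta function\<close>

text \<open>
  In terms of Jacobi's function \<open>\<vartheta>(t) = (\<Sum>n\<in>\<int>. exp (- pi * n\<^sup>2 * t))\<close> this is
  \<open>(\<vartheta>(x\<^sup>2) - 1) / 2\<close>. Squaring the argument makes the inversion formula an exchange of \<open>x\<close> and
  \<open>1 / x\<close> with the weight \<open>x\<close>, without square roots.
\<close>

definition theta_tail :: "real \<Rightarrow> real" where
  "theta_tail x = (\<Sum>n. exp (- (pi * (real (Suc n))\<^sup>2 * x\<^sup>2)))"

lemma summable_theta_tail:
  assumes "x \<noteq> 0"
  shows "summable (\<lambda>n. exp (- (pi * (real (Suc n))\<^sup>2 * x\<^sup>2)))"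
proof (rule summable_comparison_test')
  have "exp (- (pi * x\<^sup>2)) < 1" using assms by simp
  then show "summable (\<lambda>n. exp (- (pi * x\<^sup>2)) ^ n)"
    by (intro summable_geometric) auto
  show "norm (exp (- (pi * (real (Suc n))\<^sup>2 * x\<^sup>2))) \<le> exp (- (pi * x\<^sup>2)) ^ n" for n
  proof -
    have "real n \<le> (real (Suc n))\<^sup>2"
      by (simp add: power2_eq_square algebra_simps)
    then have "real n * (pi * x\<^sup>2) \<le> (real (Suc n))\<^sup>2 * (pi * x\<^sup>2)"
      by (intro mult_right_mono) auto
    then show ?thesis
      by (simp add: exp_of_nat_mult[symmetric] mult_ac)
  qed
qed

lemma sum_symmetric_interval:
  fixes c :: "int \<Rightarrow> 'a::comm_ring_1"
  assumes even: "\<And>k. c (- k) = c k"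
  shows "(\<Sum>k\<in>{-int K..int K}. c k) = c 0 + 2 * (\<Sum>n<K. c (int (Suc n)))"
proof (induction K)
  case (Suc K)
  have "{-int (Suc K)..int (Suc K)} = insert (int K + 1) (insert (-(int K + 1)) {-int K..int K})"
    by auto
  then show ?case using Suc even[of "int K + 1"] by (simp add: algebra_simps)
qed simp

text \<open>
  The translates of the period interval by \<open>-N, \<dots>, N\<close> tile \<open>[-N - 1/2, N + 1/2]\<close>.
\<close>

lemma sum_integral_translates:
  fixes F :: "real \<Rightarrow> complex"
  assumes F: "continuous_on UNIV F"
  shows "(\<Sum>m\<in>{-int N..int N}. integral {-1/2..1/2} (\<lambda>t. F (t + of_int m))) =
           integral {- (real N + 1/2)..real N + 1/2} F"
proof (induction N)
  case (Suc N)
  have int: "F integrable_on {a..b}" for a b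
    using continuous_on_subset[OF F] by (intro integrable_continuous_interval) auto
  have shift: "integral {-1/2..1/2} (\<lambda>t. F (t + c)) = integral {c - 1/2..c + 1/2} F" for c
    using integral_shift_real_ivl[of "c - 1/2" c "c + 1/2" F] by simp
  have "{-int (Suc N)..int (Suc N)} = insert (int N + 1) (insert (-int N - 1) {-int N..int N})"
    by auto
  then have "(\<Sum>m\<in>{-int (Suc N)..int (Suc N)}. integral {-1/2..1/2} (\<lambda>t. F (t + of_int m))) =
     integral {-1/2..1/2} (\<lambda>t. F (t + (real N + 1))) +
     (integral {-1/2..1/2} (\<lambda>t. F (t + (- real N - 1))) + integral {- (real N + 1/2)..real N + 1/2} F)"
    using Suc by simp
  also have "\<dots> = integral {real N + 1/2..real N + 3/2} F +
     (integral {- real N - 3/2..- real N - 1/2} F + integral {- real N - 1/2..real N + 1/2} F)"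
    unfolding shift by (simp add: algebra_simps)
  also have "\<dots> = integral {- real N - 3/2..real N + 3/2} F"
    using Henstock_Kurzweil_Integration.integral_combine[OF _ _ int, of "- real N - 3/2" "- real N - 1/2" "real N + 1/2"]
      Henstock_Kurzweil_Integration.integral_combine[OF _ _ int, of "- real N - 3/2" "real N + 1/2" "real N + 3/2"] by (simp add: add_ac)
  finally show ?case by (simp add: algebra_simps)
qed simp

lemma integral_symmetric_tendsto:
  fixes F :: "real \<Rightarrow> complex"
  assumes F: "integrable lborel F"
  shows "(\<lambda>N. integral {- (real N + 1/2)..real N + 1/2} F) \<longlonglongrightarrow> (LINT t|lborel. F t)"
proof -
  have si: "set_integrable lborel {a..b} F" for a b
    unfolding set_integrable_def by (intro integrable_mult_indicator F) simp
  have "(\<lambda>N. LINT t|lborel. indicator {- (real N + 1/2)..real N + 1/2} t *\<^sub>R F t) \<longlonglongrightarrow> (LINT t|lborel. F t)"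
  proof (rule integral_dominated_convergence[where w = "\<lambda>t. norm (F t)"])
    show "F \<in> borel_measurable lborel" using F by simp
    show "integrable lborel (\<lambda>t. norm (F t))" using F by simp
    show "(\<lambda>t. indicator {- (real N + 1/2)..real N + 1/2} t *\<^sub>R F t) \<in> borel_measurable lborel" for N
      using si unfolding set_integrable_def by (rule borel_measurable_integrable)
    show "AE t in lborel. norm (indicator {- (real N + 1/2)..real N + 1/2} t *\<^sub>R F t) \<le> norm (F t)" for N
      by (auto split: split_indicator)
    show "AE t in lborel. (\<lambda>N. indicator {- (real N + 1/2)..real N + 1/2} t *\<^sub>R F t) \<longlonglongrightarrow> F t"
    proof (rule AE_I2, rule tendsto_eventually)
      fix t :: real
      show "\<forall>\<^sub>F N in sequentially. indicator {- (real N + 1/2)..real N + 1/2} t *\<^sub>R F t = F t"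
        using eventually_ge_at_top[of "nat \<lceil>\<bar>t\<bar>\<rceil>"]
      proof eventually_elim
        case (elim N)
        then have "\<bar>t\<bar> \<le> real N" by linarith
        then show ?case by (auto split: split_indicator)
      qed
    qed
  qed
  then show ?thesis
    using set_borel_integral_eq_integral(2)[OF si] by (simp add: set_lebesgue_integral_def)
qed

text \<open>
  Poisson summation for \<open>f z = exp (- pi * a * z\<^sup>2)\<close>. The periodization \<open>h\<close> of \<open>f\<close> converges
  uniformly on the unit disc, so it is holomorphic there, and its Fourier series at 0 converges to
  \<open>h 0\<close>. Unfolding the integral over a period into an integral over the real line identifies the
  \<open>k\<close>-th coefficient of \<open>h\<close> with the Fourier transform of the Gaussian at \<open>2 * pi * k\<close>.
  The terms \<open>n\<close> and \<open>-n\<close> are summed in pairs, so that \<open>h\<close> is visibly even; hence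
  \<open>h (1/2) = h (-1/2)\<close>, which is all the periodicity that the convergence lemma needs.
\<close>

lemma gaussian_poisson_summation:
  fixes a :: real
  assumes a: "a > 0"
  defines "f \<equiv> \<lambda>z::complex. exp (- (of_real (pi * a) * z\<^sup>2))"
  shows "(\<lambda>K. \<Sum>k\<in>{-int K..int K}. complex_of_real (exp (- (pi * (of_int k)\<^sup>2 / a)) / sqrt a))
            \<longlonglongrightarrow> f 0 + (\<Sum>n. f (of_nat (Suc n)) + f (- of_nat (Suc n)))"
proof -
  define u where "u = (\<lambda>n z. f (z + of_nat (Suc n)) + f (z - of_nat (Suc n)))"
  define h where "h = (\<lambda>z. f z + (\<Sum>n. u n z))"
  define P where "P = (\<lambda>N z. f z + (\<Sum>n<N. u n z))"
  have fhol: "f holomorphic_on A" for A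
    unfolding f_def by (intro holomorphic_intros)
  have uhol: "u n holomorphic_on A" for n A
    unfolding u_def f_def by (intro holomorphic_intros)
  have Phol: "P N holomorphic_on A" for N A
    unfolding P_def by (intro holomorphic_intros fhol uhol)
  have Psum: "P N z = (\<Sum>m\<in>{-int N..int N}. f (z + of_int m))" for N z
  proof (induction N)
    case (Suc N)
    have "{-int (Suc N)..int (Suc N)} = insert (int N + 1) (insert (-int N - 1) {-int N..int N})"
      by auto
    then show ?case using Suc by (simp add: P_def u_def algebra_simps)
  qed (simp add: P_def)
  \<comment> \<open>Shifting by \<open>n + 1\<close> inside the unit disc leaves a real part of modulus at least \<open>n\<close> and an imaginary part of modulus at most 1.\<close>
  have ubound: "norm (u n z) \<le> 2 * exp (pi * a) * exp (- (pi * a)) ^ n" if z: "z \<in> cball 0 1" for n z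
  proof -
    have *: "norm (f w) \<le> exp (pi * a) * exp (- (pi * a)) ^ n"
      if w: "\<bar>Re w\<bar> \<ge> real n" "\<bar>Im w\<bar> \<le> 1" for w
    proof -
      have "(real n)\<^sup>2 \<le> (Re w)\<^sup>2" using w(1) by (metis abs_le_square_iff abs_of_nat)
      moreover have "(Im w)\<^sup>2 \<le> 1" using w(2) by (metis abs_le_square_iff abs_one one_power2)
      moreover have "real n \<le> (real n)\<^sup>2" by (cases "n = 0") (auto simp: power2_eq_square)
      ultimately have "real n - 1 \<le> Re (w\<^sup>2)" by (simp add: power2_eq_square)
      then have "(pi * a) * (real n - 1) \<le> (pi * a) * Re (w\<^sup>2)"
        using a by (intro mult_left_mono) auto
      then have "norm (f w) \<le> exp (pi * a - real n * (pi * a))"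
        unfolding f_def by (simp add: algebra_simps)
      also have "\<dots> = exp (pi * a) * exp (- (pi * a)) ^ n"
        by (simp add: exp_diff exp_minus exp_of_nat_mult divide_inverse power_inverse)
      finally show ?thesis .
    qed
    have "\<bar>Re z\<bar> \<le> 1" "\<bar>Im z\<bar> \<le> 1"
      using z abs_Re_le_cmod[of z] abs_Im_le_cmod[of z] by auto
    then have "norm (f (z + of_nat (Suc n))) \<le> exp (pi * a) * exp (- (pi * a)) ^ n"
      "norm (f (z - of_nat (Suc n))) \<le> exp (pi * a) * exp (- (pi * a)) ^ n"
      by (intro *; simp)+
    then show ?thesis
      unfolding u_def using norm_triangle_ineq[of "f (z + of_nat (Suc n))" "f (z - of_nat (Suc n))"] by linarith
  qed
  have "exp (- (pi * a)) < 1" using a by simp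
  then have "summable (\<lambda>n. 2 * exp (pi * a) * exp (- (pi * a)) ^ n)"
    by (intro summable_mult summable_geometric) auto
  then have "uniform_limit (cball 0 1) (\<lambda>N z. \<Sum>n<N. u n z) (\<lambda>z. \<Sum>n. u n z) sequentially"
    using ubound by (intro Weierstrass_m_test) auto
  then have ulim: "uniform_limit (cball 0 1) P h sequentially"
    unfolding P_def h_def by (intro uniform_limit_intros)
  have hhol: "h holomorphic_on ball 0 1"
  proof (rule holomorphic_uniform_sequence[OF open_ball])
    show "P n holomorphic_on ball 0 1" for n by (rule Phol)
    fix z :: complex assume "z \<in> ball 0 1"
    with open_ball[of "0::complex" 1] obtain d where "d > 0" "cball z d \<subseteq> ball 0 1"
      using open_contains_cball[of "ball (0::complex) 1"] by blast
    moreover have "ball 0 1 \<subseteq> cball (0::complex) 1" by auto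
    ultimately show "\<exists>d>0. cball z d \<subseteq> ball 0 1 \<and> uniform_limit (cball z d) P h sequentially"
      using uniform_limit_on_subset[OF ulim, of "cball z d"] by blast
  qed
  have feven: "f (- z) = f z" for z by (simp add: f_def)
  have "u n (- z) = u n z" for n z
  proof -
    have "- z + of_nat (Suc n) = - (z - of_nat (Suc n))" "- z - of_nat (Suc n) = - (z + of_nat (Suc n))"
      by simp_all
    then show ?thesis unfolding u_def by (simp only: feven add.commute)
  qed
  then have "h (- z) = h z" for z
    by (simp add: h_def feven)
  from this[of "1/2"] have hper: "h (1/2) = h (-1/2)" by simp
  have coeff: "fourier_coeff h k = of_real (exp (- (pi * (of_int k)\<^sup>2 / a)) / sqrt a)" for k
  proof -
    define e where "e = (\<lambda>t::complex. exp (- (2 * of_real pi * \<i> * of_int k * t)))"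
    define F where "F = (\<lambda>t::real. f (of_real t) * e (of_real t))"
    have e_per: "e (z + of_int m) = e z" for z m
    proof -
      have "exp (- (2 * of_real pi * \<i> * of_int k * of_int m)) = (1::complex)"
        unfolding exp_eq_1 by (auto intro!: exI[of _ "- k * m"])
      moreover have "e (z + of_int m) = e z * exp (- (2 * of_real pi * \<i> * of_int k * of_int m))"
        unfolding e_def by (simp add: exp_add[symmetric] ring_distribs)
      ultimately show ?thesis by simp
    qed
    have Fcont: "continuous_on UNIV F"
      unfolding F_def f_def e_def by (intro continuous_intros)
    have e_bound: "norm (e (of_real t)) = 1" for t by (simp add: e_def)
    \<comment> \<open>Two limits of the coefficients of the partial periodizations: by uniform convergence they tend to the coefficient of \<open>h\<close>, by unfolding to the integral over the whole line.\<close>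
    have 1: "(\<lambda>N. fourier_coeff (P N) k) \<longlonglongrightarrow> fourier_coeff h k"
    proof -
      have "uniform_limit {-1/2..1/2} (\<lambda>N t. P N (of_real t)) (\<lambda>t. h (of_real t)) sequentially"
        unfolding uniform_limit_iff
      proof (intro allI impI)
        fix \<epsilon> :: real assume "\<epsilon> > 0"
        with ulim have "\<forall>\<^sub>F N in sequentially. \<forall>z\<in>cball 0 1. dist (P N z) (h z) < \<epsilon>"
          unfolding uniform_limit_iff by blast
        then show "\<forall>\<^sub>F N in sequentially. \<forall>t\<in>{-1/2..1/2}. dist (P N (of_real t)) (h (of_real t)) < \<epsilon>"
          by eventually_elim (use of_real_in_unit_ball ball_subset_cball in blast)
      qed
      then have "uniform_limit {-1/2..1/2} (\<lambda>N t. P N (of_real t) * e (of_real t)) (\<lambda>t. h (of_real t) * e (of_real t)) sequentially"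
        unfolding uniform_limit_iff dist_norm left_diff_distrib[symmetric] norm_mult e_bound by simp
      moreover have "continuous_on {-1/2..1/2} (\<lambda>t. P N (of_real t) * e (of_real t))" for N
        unfolding e_def
        by (intro continuous_intros continuous_on_compose2[OF holomorphic_on_imp_continuous_on[OF Phol[of N UNIV]]]) auto
      ultimately obtain I J where IJ: "\<And>N. ((\<lambda>t. P N (of_real t) * e (of_real t)) has_integral I N) {-1/2..1/2}"
         "((\<lambda>t. h (of_real t) * e (of_real t)) has_integral J) {-1/2..1/2}" "I \<longlonglongrightarrow> J"
        using uniform_limit_integral[where F = sequentially and a = "-1/2::real" and b = "1/2::real"
           and f = "\<lambda>N t. P N (of_real t) * e (of_real t)" and g = "\<lambda>t. h (of_real t) * e (of_real t)"]
        by (auto simp: trivial_limit_sequentially)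
      have "fourier_coeff (P N) k = I N" for N
        using integral_unique[OF IJ(1)] unfolding fourier_coeff_def e_def .
      moreover have "fourier_coeff h k = J"
        using integral_unique[OF IJ(2)] unfolding fourier_coeff_def e_def .
      ultimately show ?thesis using IJ(3) by simp
    qed
    have 2: "fourier_coeff (P N) k = integral {- (real N + 1/2)..real N + 1/2} F" for N
    proof -
      have "fourier_coeff (P N) k = integral {-1/2..1/2} (\<lambda>t. \<Sum>m\<in>{-int N..int N}. F (t + of_int m))"
        unfolding fourier_coeff_def Psum F_def sum_distrib_right
        using e_per unfolding e_def by (intro integral_cong sum.cong) auto
      also have "\<dots> = (\<Sum>m\<in>{-int N..int N}. integral {-1/2..1/2} (\<lambda>t. F (t + of_int m)))"
        by (intro integral_sum integrable_continuous_interval continuous_on_compose2[OF Fcont])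
           (auto intro!: continuous_intros)
      finally show ?thesis by (simp only: sum_integral_translates[OF Fcont])
    qed
    \<comment> \<open>The Gaussian \<open>f\<close> is a multiple of the normal density with this variance.\<close>
    define v where "v = 1 / (2 * pi * a)"
    have v: "v > 0" using a by (simp add: v_def)
    have F: "F t = of_real (1 / sqrt a) * (exp (\<i> * of_real ((- 2 * pi * of_int k) * t)) * complex_of_real (normal_density 0 (sqrt v) t))" for t
    proof -
      have "normal_density 0 (sqrt v) t = sqrt a * exp (- (pi * a * t\<^sup>2))"
        using a v by (simp add: normal_density_def v_def real_sqrt_divide field_simps)
      then show ?thesis using a
        by (simp add: F_def f_def e_def exp_of_real[symmetric] mult_ac)
    qed
    have "integrable lborel (\<lambda>t. exp (\<i> * of_real ((- 2 * pi * of_int k) * t)) * complex_of_real (normal_density 0 (sqrt v) t))"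
    proof (rule Bochner_Integration.integrable_bound[OF integrable_normal_density[of "sqrt v" 0]])
      show "AE t in lborel. norm (exp (\<i> * of_real ((- 2 * pi * of_int k) * t)) * complex_of_real (normal_density 0 (sqrt v) t))
         \<le> norm (normal_density 0 (sqrt v) t)"
        by (auto simp: norm_mult)
    qed (use v in auto)
    then have "integrable lborel F"
      unfolding F by (rule integrable_mult_right)
    then have "(\<lambda>N. fourier_coeff (P N) k) \<longlonglongrightarrow> (LINT t|lborel. F t)"
      unfolding 2 by (rule integral_symmetric_tendsto)
    with 1 have "fourier_coeff h k = (LINT t|lborel. F t)"
      using LIMSEQ_unique by blast
    also have "\<dots> = of_real (1 / sqrt a) * of_real (exp (- (v * (- 2 * pi * of_int k)\<^sup>2 / 2)))"
      unfolding F by (simp only: integral_mult_right_zero gaussian_fourier[OF v])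
    also have "v * (- 2 * pi * of_int k)\<^sup>2 / 2 = pi * (of_int k)\<^sup>2 / a"
      using a by (simp add: v_def power_mult_distrib power2_eq_square field_simps)
    finally show ?thesis by simp
  qed
  have "h 0 = f 0 + (\<Sum>n. f (of_nat (Suc n)) + f (- of_nat (Suc n)))"
    by (simp add: h_def u_def)
  then show ?thesis
    using fourier_partial_sums_tendsto[OF hhol hper] unfolding coeff by simp
qed

text \<open>
  Both sides of the Poisson formula with \<open>a = x\<^sup>2\<close> are even series: the summands for \<open>k\<close> and
  \<open>-k\<close> combine to twice a theta tail, and the summand for 0 gives the 1.
\<close>

theorem theta_inversion:
  assumes x: "x > 0"
  shows "1 + 2 * theta_tail (1 / x) = x * (1 + 2 * theta_tail x)"
proof -
  let ?c = "\<lambda>k::int. complex_of_real (exp (- (pi * (of_int k)\<^sup>2 / x\<^sup>2)) / sqrt (x\<^sup>2))"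
  let ?g = "\<lambda>y n. exp (- (pi * (real (Suc n))\<^sup>2 * y\<^sup>2))"
  have sums: "?g y sums theta_tail y" if "y > 0" for y
    unfolding theta_tail_def using summable_theta_tail[of y] that by (intro summable_sums) auto
  have "(\<lambda>K. \<Sum>k\<in>{-int K..int K}. ?c k) = (\<lambda>K. of_real ((1 + 2 * (\<Sum>n<K. ?g (1/x) n)) / x))"
  proof
    fix K
    have "(\<Sum>k\<in>{-int K..int K}. ?c k) = ?c 0 + 2 * (\<Sum>n<K. ?c (int (Suc n)))"
      by (rule sum_symmetric_interval) simp
    also have "\<dots> = of_real ((1 + 2 * (\<Sum>n<K. ?g (1/x) n)) / x)"
      using x by (simp add: sum_divide_distrib[symmetric] add_divide_distrib power_divide power2_eq_square)
    finally show "(\<Sum>k\<in>{-int K..int K}. ?c k) = of_real ((1 + 2 * (\<Sum>n<K. ?g (1/x) n)) / x)" .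
  qed
  moreover have "(\<lambda>K. complex_of_real ((1 + 2 * (\<Sum>n<K. ?g (1/x) n)) / x)) \<longlonglongrightarrow> of_real ((1 + 2 * theta_tail (1/x)) / x)"
    using sums[of "1/x"] x unfolding sums_def by (intro tendsto_intros) auto
  ultimately have 1: "(\<lambda>K. \<Sum>k\<in>{-int K..int K}. ?c k) \<longlonglongrightarrow> of_real ((1 + 2 * theta_tail (1/x)) / x)"
    by simp
  have "(\<lambda>n. complex_of_real (2 * ?g x n)) sums of_real (2 * theta_tail x)"
    using x by (intro sums_of_real sums_mult sums) auto
  moreover have "complex_of_real (2 * ?g x n) =
      exp (- (of_real (pi * x\<^sup>2) * (of_nat (Suc n))\<^sup>2)) + exp (- (of_real (pi * x\<^sup>2) * (- of_nat (Suc n))\<^sup>2))" for n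
    unfolding power2_minus by (simp add: exp_of_real[symmetric] mult_ac)
  ultimately have "(\<Sum>n. exp (- (of_real (pi * x\<^sup>2) * (of_nat (Suc n))\<^sup>2)) + exp (- (of_real (pi * x\<^sup>2) * (- of_nat (Suc n))\<^sup>2))) =
      complex_of_real (2 * theta_tail x)"
    by (simp add: sums_iff)
  then have "(\<lambda>K. \<Sum>k\<in>{-int K..int K}. ?c k) \<longlonglongrightarrow> of_real (1 + 2 * theta_tail x)"
    using gaussian_poisson_summation[of "x\<^sup>2"] x by simp
  with 1 have "complex_of_real ((1 + 2 * theta_tail (1/x)) / x) = of_real (1 + 2 * theta_tail x)"
    using LIMSEQ_unique by blast
  then show ?thesis using x by (simp only: of_real_eq_iff) (simp add: field_simps)
qed

section \<open>The Riemann xi function and the continuation of zeta\<close>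

lemma powr_of_pos_real:
  "x > 0 \<Longrightarrow> complex_of_real x powr z = exp (z * of_real (ln x))"
  by (simp add: powr_def Ln_of_real)

text \<open>
  The substitution \<open>t = c * x\<^sup>2\<close> in Euler's integral for \<open>Gamma (s / 2)\<close>; the constant \<open>?K\<close> in the
  proof collects the Jacobian and the powers of \<open>c\<close>.
\<close>

lemma gaussian_mellin:
  fixes c :: real and s :: complex
  assumes c: "c > 0" and s: "Re s > 0"
  shows "set_integrable lborel {0<..} (\<lambda>x. of_real x powr (s - 1) * of_real (exp (- (c * x\<^sup>2))))" (is ?int)
    and "(LBINT x:{0<..}. of_real x powr (s - 1) * of_real (exp (- (c * x\<^sup>2)))) =
           1 / 2 * of_real c powr (- s / 2) * Gamma (s / 2)" (is ?eq)
proof -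
  let ?f = "\<lambda>t. complex_of_real t powr (s / 2 - 1) / of_real (exp t)"
  let ?K = "2 * complex_of_real c powr (s / 2)"
  have meas: "set_borel_measurable borel {0<..} ?f"
    unfolding set_borel_measurable_def by measurable
  have int: "set_integrable lborel {0<..} ?f"
    using absolutely_integrable_Gamma_integral'[of "s / 2"] s
    by (simp add: set_integrable_lborel_iff_absolutely_integrable[OF meas])
  have val: "(LBINT t:{0<..}. ?f t) = Gamma (s / 2)"
    using Gamma_integral_complex'[of "s / 2"] s set_borel_integral_eq_integral(2)[OF int]
    by (simp add: integral_unique)
  have img: "(\<lambda>x. c * x\<^sup>2) ` {0<..} = {0<..}"
  proof (intro equalityI subsetI)
    fix y :: real assume "y \<in> {0<..}"
    then show "y \<in> (\<lambda>x. c * x\<^sup>2) ` {0<..}"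
      using c by (intro image_eqI[of _ _ "sqrt (y / c)"]) auto
  qed (use c in auto)
  have inj: "inj_on (\<lambda>x. c * x\<^sup>2) {0<..}"
    using c by (auto simp: inj_on_def)
  have deriv: "((\<lambda>x. c * x\<^sup>2) has_field_derivative 2 * c * x) (at x within {0<..})" for x
    by (auto intro!: derivative_eq_intros)
  have integrand: "\<bar>2 * c * x\<bar> *\<^sub>R ?f (c * x\<^sup>2) =
      ?K * (of_real x powr (s - 1) * of_real (exp (- (c * x\<^sup>2))))" if "x > 0" for x
  proof -
    have "of_real (2 * c * x) * complex_of_real (c * x\<^sup>2) powr (s / 2 - 1) =
            ?K * complex_of_real x powr (s - 1)"
    proof -
      have "ln (c * x\<^sup>2) = ln c + 2 * ln x"
        using c that by (simp add: ln_mult ln_realpow)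
      moreover have "c * x\<^sup>2 > 0" using c that by simp
      ultimately have "complex_of_real (c * x\<^sup>2) powr (s / 2 - 1) =
           exp (s / 2 * of_real (ln c) + (s - 1) * of_real (ln x) - of_real (ln c) - of_real (ln x))"
        by (simp only: powr_of_pos_real) (simp add: algebra_simps)
      also have "\<dots> = exp (s / 2 * of_real (ln c)) * exp ((s - 1) * of_real (ln x)) / (of_real c * of_real x)"
        using c that by (simp add: exp_add exp_diff exp_of_real)
      finally show ?thesis using c that by (simp add: powr_of_pos_real)
    qed
    then show ?thesis using c that
      by (simp add: scaleR_conv_of_real exp_minus field_simps)
  qed
  have meas': "set_borel_measurable borel {0<..} (\<lambda>x. \<bar>2 * c * x\<bar> *\<^sub>R ?f (c * x\<^sup>2))"
    unfolding set_borel_measurable_def by measurable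
  have meas'': "set_borel_measurable borel ((\<lambda>x. c * x\<^sup>2) ` {0<..}) ?f"
    using meas by (simp add: img)
  note cov = lborel_change_of_variables[OF _ _ deriv inj meas' meas'', unfolded img]
  have K: "?K \<noteq> 0" using c by simp
  have "set_integrable lborel {0<..} (\<lambda>x. \<bar>2 * c * x\<bar> *\<^sub>R ?f (c * x\<^sup>2))"
    using cov(1) int by simp
  also have "?this \<longleftrightarrow> set_integrable lborel {0<..} (\<lambda>x. ?K * (of_real x powr (s - 1) * of_real (exp (- (c * x\<^sup>2)))))"
    using integrand by (intro set_integrable_cong) auto
  finally show ?int using K by simp
  have "(LBINT x:{0<..}. ?K * (of_real x powr (s - 1) * of_real (exp (- (c * x\<^sup>2))))) =
     (LBINT x:{0<..}. \<bar>2 * c * x\<bar> *\<^sub>R ?f (c * x\<^sup>2))"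
    using integrand by (intro set_lebesgue_integral_cong) auto
  also have "\<dots> = Gamma (s / 2)"
    using cov(2) val by simp
  finally have "?K * (LBINT x:{0<..}. of_real x powr (s - 1) * of_real (exp (- (c * x\<^sup>2)))) = Gamma (s / 2)"
    by simp
  then show ?eq using K c by (simp add: powr_minus field_simps)
qed

lemma theta_tail_nonneg: "x \<noteq> 0 \<Longrightarrow> theta_tail x \<ge> 0"
  unfolding theta_tail_def by (intro suminf_nonneg summable_theta_tail) auto

lemma measurable_theta_tail [measurable]: "theta_tail \<in> borel_measurable borel"
  unfolding theta_tail_def[abs_def] by measurable

text \<open>
  Summing the Mellin transforms of the Gaussians \<open>exp (- pi * (n + 1)\<^sup>2 * (r * x)\<^sup>2)\<close> produces the
  Dirichlet series. Sum and integral may be exchanged because the moduli of the terms are the same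
  terms with \<open>s\<close> replaced by \<open>Re s > 1\<close>, whose integrals are multiples of \<open>(n + 1) powr (- Re s)\<close>.
  The scale \<open>r\<close> is kept since the mixture involves \<open>theta_tail\<close> at all scales.
\<close>

lemma theta_tail_mellin:
  fixes r :: real and s :: complex
  assumes r: "r > 0" and s: "Re s > 1"
  shows "set_integrable lborel {0<..} (\<lambda>x. of_real x powr (s - 1) * of_real (theta_tail (r * x)))" (is ?int)
    and "(LBINT x:{0<..}. of_real x powr (s - 1) * of_real (theta_tail (r * x))) =
           of_real r powr (- s) *
             (1 / 2 * of_real pi powr (- s / 2) * Gamma (s / 2) * (\<Sum>n. 1 / of_nat (Suc n) powr s))" (is ?eq)
proof -
  define c where "c = (\<lambda>n. pi * (real (Suc n))\<^sup>2 * r\<^sup>2)"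
  define T where "T = (\<lambda>z n x. indicator {0<..} x *\<^sub>R (complex_of_real x powr (z - 1) * of_real (exp (- (c n * x\<^sup>2)))))"
  have c: "c n > 0" for n using r by (simp add: c_def)
  have cpowr: "complex_of_real (c n) powr (- z / 2) =
     of_real pi powr (- z / 2) * of_real r powr (- z) * (1 / of_nat (Suc n) powr z)" for z n
  proof -
    have "ln (c n) = ln pi + 2 * ln (real (Suc n)) + 2 * ln r"
      using r by (simp add: c_def ln_mult ln_realpow)
    then have "complex_of_real (c n) powr (- z / 2) =
       exp (- z / 2 * of_real (ln pi) + - z * of_real (ln r) + - (z * of_real (ln (real (Suc n)))))"
      unfolding powr_of_pos_real[OF c] by (simp add: algebra_simps del: of_nat_Suc)
    moreover have "exp (- (z * of_real (ln (real (Suc n))))) = 1 / complex_of_nat (Suc n) powr z"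
      using powr_of_pos_real[of "real (Suc n)" z] by (simp add: exp_minus divide_inverse del: of_nat_Suc)
    ultimately show ?thesis
      using powr_of_pos_real[OF pi_gt_zero] powr_of_pos_real[OF r] by (simp only: exp_add)
  qed
  have Tint: "integrable lborel (T z n)" and Tval: "(LINT x|lborel. T z n x) =
      of_real pi powr (- z / 2) * of_real r powr (- z) * Gamma (z / 2) / 2 * (1 / of_nat (Suc n) powr z)"
    if "Re z > 0" for z n
    using gaussian_mellin[OF c[of n] that] unfolding T_def set_integrable_def set_lebesgue_integral_def cpowr
    by simp_all
  have normT: "complex_of_real (norm (T s n x)) = T (of_real (Re s)) n x" for n x
  proof (cases "x > 0")
    case True
    then have "complex_of_real x powr (of_real (Re s) - 1) = of_real (x powr (Re s - 1))"
      using powr_of_real[of x "Re s - 1"] by simp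
    then show ?thesis using True by (simp add: T_def norm_mult norm_powr_real_powr)
  qed (simp add: T_def)
  have normint: "summable (\<lambda>n. LINT x|lborel. norm (T s n x))"
  proof -
    let ?C = "of_real pi powr (- of_real (Re s) / 2) * of_real r powr (- of_real (Re s)) * Gamma (of_real (Re s) / 2) / (2::complex)"
    have "complex_of_real (LINT x|lborel. norm (T s n x)) = ?C * (1 / of_nat (Suc n) powr of_real (Re s))" for n
      unfolding integral_complex_of_real[symmetric] normT using s by (subst Tval) auto
    from arg_cong[OF this, of norm]
    have "\<bar>LINT x|lborel. norm (T s n x)\<bar> = norm (?C * (1 / of_nat (Suc n) powr of_real (Re s)))" for n
      unfolding norm_of_real .
    moreover have "norm (1 / complex_of_nat (Suc n) powr of_real (Re s)) = real (Suc n) powr (- Re s)" for n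
      by (simp add: norm_divide norm_inverse norm_powr_real_powr powr_minus divide_inverse del: of_nat_Suc)
    moreover have "(LINT x|lborel. norm (T s n x)) \<ge> 0" for n
      by simp
    ultimately have eq: "(LINT x|lborel. norm (T s n x)) = norm ?C * real (Suc n) powr (- Re s)" for n
      unfolding norm_mult by (metis abs_of_nonneg)
    have "summable (\<lambda>n. real (Suc n) powr (- Re s))"
      using s summable_real_powr_iff[of "- Re s"] by (subst summable_Suc_iff) simp
    then show ?thesis unfolding eq by (rule summable_mult)
  qed
  have Tsums: "(\<lambda>n. T z n x) sums (indicator {0<..} x *\<^sub>R (complex_of_real x powr (z - 1) * of_real (theta_tail (r * x))))" for z x
  proof (cases "x > 0")
    case True
    then have "(\<lambda>n. exp (- (pi * (real (Suc n))\<^sup>2 * (r * x)\<^sup>2))) sums theta_tail (r * x)"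
      unfolding theta_tail_def using r by (intro summable_sums summable_theta_tail) simp
    then have "(\<lambda>n. complex_of_real x powr (z - 1) * of_real (exp (- (pi * (real (Suc n))\<^sup>2 * (r * x)\<^sup>2))))
       sums (complex_of_real x powr (z - 1) * of_real (theta_tail (r * x)))"
      by (intro sums_mult sums_of_real)
    then show ?thesis using True by (simp add: T_def c_def power_mult_distrib mult_ac)
  qed (simp add: T_def)
  have sumnorm: "summable (\<lambda>n. norm (T s n x))" for x
  proof -
    have "summable (\<lambda>n. T (of_real (Re s)) n x)" using Tsums by (rule sums_summable)
    then have "summable (\<lambda>n. complex_of_real (norm (T s n x)))" by (simp add: normT)
    then show ?thesis by (simp only: summable_complex_of_real)
  qed
  have T0: "integrable lborel (T s n)" for n using Tint s by simp
  have Tsuminf: "(\<Sum>n. T s n x) = indicator {0<..} x *\<^sub>R (complex_of_real x powr (s - 1) * of_real (theta_tail (r * x)))" for x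
    using Tsums[of s x] by (simp add: sums_iff)
  have AE: "AE x in lborel. summable (\<lambda>n. norm (T s n x))" using sumnorm by simp
  show ?int
    using integrable_suminf[OF T0 AE normint] unfolding Tsuminf set_integrable_def .
  have "(LBINT x:{0<..}. of_real x powr (s - 1) * of_real (theta_tail (r * x))) = (\<Sum>n. LINT x|lborel. T s n x)"
    using integral_suminf[OF T0 AE normint] unfolding Tsuminf set_lebesgue_integral_def .
  also have "\<dots> = (\<Sum>n. (of_real pi powr (- s / 2) * of_real r powr (- s) * Gamma (s / 2) / 2) * (1 / of_nat (Suc n) powr s))"
    using s by (subst Tval) auto
  also have "\<dots> = (of_real pi powr (- s / 2) * of_real r powr (- s) * Gamma (s / 2) / 2) * (\<Sum>n. 1 / of_nat (Suc n) powr s)"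
  proof (rule suminf_mult)
    have "summable (\<lambda>n. exp (complex_of_real (ln (real (Suc n))) * - s))"
      using s summable_complex_powr_iff[of "- s"] by (subst summable_Suc_iff) simp
    moreover have "exp (complex_of_real (ln (real (Suc n))) * - s) = 1 / complex_of_nat (Suc n) powr s" for n
      using powr_of_pos_real[of "real (Suc n)" s]
      by (simp add: exp_minus divide_inverse mult.commute del: of_nat_Suc)
    ultimately show "summable (\<lambda>n. 1 / complex_of_nat (Suc n) powr s)" by simp
  qed
  finally show ?eq by simp
qed

text \<open>
  On \<open>{1<..}\<close> larger exponents give larger powers, so an exponent of the half-plane of convergence
  of the Mellin transform dominates any given one.
\<close>

lemma theta_tail_powr_integrable:
  "set_integrable lborel {1<..} (\<lambda>x. x powr a * theta_tail x)"
proof -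
  define \<sigma> where "\<sigma> = max 2 (a + 1)"
  have "set_integrable lborel {0<..} (\<lambda>x. complex_of_real x powr (of_real \<sigma> - 1) * of_real (theta_tail (1 * x)))"
    by (rule theta_tail_mellin) (auto simp: \<sigma>_def)
  then have "set_integrable lborel {0<..} (\<lambda>x. complex_of_real x powr (of_real \<sigma> - 1) * of_real (theta_tail x))"
    by simp
  then have "set_integrable lborel {1<..} (\<lambda>x. complex_of_real x powr (of_real \<sigma> - 1) * of_real (theta_tail x))"
    by (rule set_integrable_subset) auto
  then show ?thesis
  proof (rule set_integrable_bound)
    show "set_borel_measurable lborel {1<..} (\<lambda>x. x powr a * theta_tail x)"
      unfolding set_borel_measurable_def by measurable
    show "AE x in lborel. x \<in> {1<..} \<longrightarrow> norm (x powr a * theta_tail x) \<le>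
        norm (complex_of_real x powr (of_real \<sigma> - 1) * of_real (theta_tail x))"
      by (auto intro!: AE_I2 mult_right_mono powr_mono
               simp: norm_mult norm_powr_real_powr abs_mult theta_tail_nonneg \<sigma>_def)
  qed
qed

lemma powr_integral_to_infinity:
  fixes w :: complex
  assumes w: "Re w > 1"
  shows "set_integrable lborel {1<..} (\<lambda>y. complex_of_real y powr (- w))" (is ?int)
    and "(LBINT y:{1<..}. complex_of_real y powr (- w)) = 1 / (w - 1)" (is ?eq)
proof -
  have "(\<lambda>y. y powr (- Re w)) integrable_on {1..}"
    using has_integral_powr_to_inf[of "- Re w" 1] w by (auto simp: integrable_on_def)
  then have abs: "(\<lambda>y. y powr (- Re w)) absolutely_integrable_on {1..}"
    by (intro nonnegative_absolutely_integrable_1) auto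
  have "set_borel_measurable borel {1..} (\<lambda>y::real. y powr (- Re w))"
    unfolding set_borel_measurable_def by measurable
  from set_integrable_lborel_iff_absolutely_integrable[OF this] abs
  have "set_integrable lborel {1..} (\<lambda>y. y powr (- Re w))"
    by simp
  then have "set_integrable lborel {1<..} (\<lambda>y. y powr (- Re w))"
    by (rule set_integrable_subset) auto
  then have "set_integrable lborel {1<..} (\<lambda>y. y powr Re (- w) * 1)"
    by simp
  from set_integrable_powr_complex[OF _ _ this] show int: ?int
    by auto
  have w1: "1 - w \<noteq> 0" using w by auto
  have "(LBINT y=1..\<infinity>. complex_of_real y powr (- w)) = 0 - 1 / (1 - w)"
  proof (rule interval_integral_FTC_integrable)
    fix x :: real assume "(1::ereal) < ereal x"
    then have x: "x > 1" by simp
    have "((\<lambda>z. z powr (1 - w) / (1 - w)) has_field_derivative (complex_of_real x powr (- w))) (at (of_real x))"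
      using x w1 by (auto intro!: derivative_eq_intros)
    then show "((\<lambda>y. complex_of_real y powr (1 - w) / (1 - w)) has_vector_derivative complex_of_real x powr (- w)) (at x)"
      by (rule has_vector_derivative_real_field)
    show "isCont (\<lambda>y. complex_of_real y powr (- w)) x"
      using x by (intro continuous_intros) (auto simp: complex_nonpos_Reals_iff)
  next
    show "set_integrable lborel (einterval 1 \<infinity>) (\<lambda>y. complex_of_real y powr (- w))"
      using int by (simp add: einterval_eq one_ereal_def)
    have "((\<lambda>y. complex_of_real y powr (1 - w) / (1 - w)) \<longlongrightarrow> complex_of_real 1 powr (1 - w) / (1 - w)) (at_right 1)"
      using w1 by (intro tendsto_intros) (auto simp: complex_nonpos_Reals_iff)
    then show "(((\<lambda>y. complex_of_real y powr (1 - w) / (1 - w)) \<circ> real_of_ereal) \<longlongrightarrow> 1 / (1 - w)) (at_right 1)"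
      unfolding one_ereal_def ereal_tendsto_simps by simp
    have "((\<lambda>y. complex_of_real y powr (1 - w) / (1 - w)) \<longlongrightarrow> 0 / (1 - w)) at_top"
      using w1 w by (intro tendsto_intros tendsto_neg_powr_complex_of_real filterlim_ident) auto
    then show "(((\<lambda>y. complex_of_real y powr (1 - w) / (1 - w)) \<circ> real_of_ereal) \<longlongrightarrow> 0) (at_left \<infinity>)"
      unfolding ereal_tendsto_simps by simp
  qed simp
  then have "(LBINT y:{1<..}. complex_of_real y powr (- w)) = 0 - 1 / (1 - w)"
    by (simp add: interval_lebesgue_integral_def einterval_eq one_ereal_def)
  then show ?eq
    by (metis diff_0 minus_diff_eq minus_divide_right)
qed

text \<open>
  Restricting to \<open>{1<..}\<close> makes all exponents admissible, so this is an entire function of \<open>s\<close>.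
\<close>

definition theta_power_integral :: "complex \<Rightarrow> complex" where
  "theta_power_integral s = (LBINT x:{1<..}. of_real x powr s * of_real (theta_tail x))"

lemma theta_power_integral_entire: "theta_power_integral holomorphic_on UNIV"
  unfolding theta_power_integral_def[abs_def]
  by (intro holomorphic_power_integral theta_tail_powr_integrable) auto

text \<open>
  Riemann's formula for the completed zeta function. Entirety and the symmetry under
  \<open>s \<mapsto> 1 - s\<close>, which exchanges the two integrals, can be read off; the constant \<open>1 / 2\<close>
  is what is left of the simple poles at 0 and 1 after multiplication by \<open>s * (s - 1)\<close>.
\<close>

definition riemann_xi :: "complex \<Rightarrow> complex" where
  "riemann_xi s = 1 / 2 + s * (s - 1) * (theta_power_integral (s - 1) + theta_power_integral (- s))"

lemma riemann_xi_entire: "riemann_xi holomorphic_on UNIV"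
proof -
  have *: "(\<lambda>s. theta_power_integral (f s)) holomorphic_on UNIV" if "f holomorphic_on UNIV" for f
    using holomorphic_on_compose_gen[OF that theta_power_integral_entire] by (simp add: o_def)
  show ?thesis
    unfolding riemann_xi_def[abs_def] by (intro holomorphic_intros *)
qed

lemma riemann_xi_symmetric: "riemann_xi (1 - s) = riemann_xi s"
  by (simp add: riemann_xi_def algebra_simps)

text \<open>
  Riemann's argument: fold \<open>(0, 1)\<close> onto \<open>(1, \<infinity>)\<close> by \<open>x \<mapsto> 1 / x\<close>. The inversion formula turns
  \<open>theta_tail (1 / y)\<close> into \<open>y * theta_tail y + (y - 1) / 2\<close>; the first summand gives the second
  integral in \<open>riemann_xi\<close>, the other one gives \<open>1 / (2 * (s - 1)) - 1 / (2 * s)\<close>, whose product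
  with \<open>s * (s - 1)\<close> is \<open>1 / 2\<close>.
\<close>

lemma theta_tail_mellin_eq_riemann_xi:
  assumes s: "Re s > 1"
  shows "s * (s - 1) * (LBINT x:{0<..}. of_real x powr (s - 1) * of_real (theta_tail x)) = riemann_xi s"
proof -
  let ?F = "\<lambda>z x. complex_of_real x powr z * of_real (theta_tail x)"
  have int: "set_integrable lborel {0<..} (?F (s - 1))"
    using theta_tail_mellin(1)[of 1 s] s by simp
  have int01: "set_integrable lborel {0<..<1} (?F (s - 1))"
    by (rule set_integrable_subset[OF int]) auto
  have int1: "set_integrable lborel {1<..} (?F z)" for z
    by (rule set_integrable_powr_complex[OF _ _ theta_tail_powr_integrable]) auto
  have "(LBINT x:{0<..}. ?F (s - 1) x) = (LBINT x:{0<..<1} \<union> {1<..}. ?F (s - 1) x)"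
    by (rule set_integral_discrete_difference[of "{1}"]) auto
  also have "\<dots> = (LBINT x:{0<..<1}. ?F (s - 1) x) + (LBINT x:{1<..}. ?F (s - 1) x)"
    using int01 int1 by (intro set_integral_Un) auto
  also have "(LBINT x:{0<..<1}. ?F (s - 1) x) = (LBINT y:{1<..}. (1 / y\<^sup>2) *\<^sub>R ?F (s - 1) (1 / y))"
    by (rule lborel_inversion(2)[symmetric])
       (auto simp: image_inverse_greaterThan_1 set_borel_measurable_def)
  also have "\<dots> = (LBINT y:{1<..}. ?F (- s) y + (1 / 2 * complex_of_real y powr (- s) - 1 / 2 * complex_of_real y powr (- (s + 1))))"
  proof (intro set_lebesgue_integral_cong allI impI)
    fix y :: real assume "y \<in> {1<..}"
    then have y: "y > 1" by simp
    have th: "theta_tail (1 / y) = y * theta_tail y + (y - 1) / 2"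
      using theta_inversion[of y] y by (simp add: field_simps)
    have p: "complex_of_real (1 / y) powr (s - 1) = of_real y powr (- s) * of_real y"
    proof -
      have "complex_of_real (1 / y) powr (s - 1) = exp (- s * of_real (ln y) + of_real (ln y))"
        using y by (subst powr_of_pos_real) (simp_all add: ln_div algebra_simps)
      also have "\<dots> = exp (- s * of_real (ln y)) * of_real y"
        using y by (simp only: exp_add exp_of_real) simp
      finally show ?thesis using y by (simp add: powr_of_pos_real)
    qed
    have p1: "complex_of_real y powr (- (s + 1)) = of_real y powr (- s) / of_real y"
      using y by (simp add: powr_diff)
    show "(1 / y\<^sup>2) *\<^sub>R ?F (s - 1) (1 / y) = ?F (- s) y + (1 / 2 * complex_of_real y powr (- s) - 1 / 2 * complex_of_real y powr (- (s + 1)))"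
      unfolding th p p1 using y by (simp add: scaleR_conv_of_real power2_eq_square field_simps)
  qed simp
  also have "\<dots> = theta_power_integral (- s) + (1 / 2 * (1 / (s - 1)) - 1 / 2 * (1 / s))"
    using powr_integral_to_infinity[of s] powr_integral_to_infinity[of "s + 1"] s int1[of "- s"]
    by (simp add: theta_power_integral_def mult.commute)
  finally have eq: "(LBINT x:{0<..}. ?F (s - 1) x) =
      theta_power_integral (- s) + (1 / 2 * (1 / (s - 1)) - 1 / 2 * (1 / s)) + theta_power_integral (s - 1)"
    unfolding theta_power_integral_def .
  have "s \<noteq> 0" "s - 1 \<noteq> 0" using s by auto
  then have "s * (s - 1) * (1 / 2 * (1 / (s - 1)) - 1 / 2 * (1 / s)) = 1 / 2"
    by (simp add: field_simps)
  then show ?thesis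
    unfolding eq riemann_xi_def distrib_left by simp
qed

lemma not_nonpos_Int_if_Re_pos: "Re z > 0 \<Longrightarrow> z \<notin> \<int>\<^sub>\<le>\<^sub>0"
  by (auto elim!: nonpos_Ints_cases)

text \<open>
  Solving the Mellin identity for the Dirichlet series gives a candidate for the continuation. Its
  factor \<open>s * Gamma (s / 2)\<close> is moved over as \<open>2 * Gamma (s / 2 + 1)\<close>, whose reciprocal is
  entire, so no singularity remains but the one at 1. Thus a function as in the definition
  of \<open>zeta\<close> exists, and since the punctured plane is connected, \<open>zeta\<close> equals the candidate.
\<close>

lemma zeta_props:
  shows zeta_eq_Dirichlet_series: "Re s > 1 \<Longrightarrow> zeta s = (\<Sum>n. 1 / of_nat (Suc n) powr s)"
    and zeta_eq_riemann_xi: "s \<noteq> 1 \<Longrightarrow>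
      zeta s = riemann_xi s * of_real pi powr (s / 2) * rGamma (s / 2 + 1) / (s - 1)"
proof -
  define Z where "Z = (\<lambda>s. riemann_xi s * of_real pi powr (s / 2) * rGamma (s / 2 + 1) / (s - 1))"
  have Zhol: "Z holomorphic_on (- {1})"
    unfolding Z_def
    by (intro holomorphic_intros holomorphic_on_subset[OF riemann_xi_entire]) auto
  have Zeq: "Z s = (\<Sum>n. 1 / of_nat (Suc n) powr s)" if s: "Re s > 1" for s
  proof -
    have xi: "riemann_xi s = s * (s - 1) * (1 / 2 * of_real pi powr (- s / 2) * Gamma (s / 2) * (\<Sum>n. 1 / of_nat (Suc n) powr s))"
    proof -
      have "(LBINT x:{0<..}. of_real x powr (s - 1) * of_real (theta_tail x)) =
          1 / 2 * of_real pi powr (- s / 2) * Gamma (s / 2) * (\<Sum>n. 1 / of_nat (Suc n) powr s)"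
        using theta_tail_mellin(2)[of 1 s] s by simp
      then show ?thesis
        unfolding theta_tail_mellin_eq_riemann_xi[OF s, symmetric] by (rule arg_cong)
    qed
    have gam: "s / 2 * Gamma (s / 2) * rGamma (s / 2 + 1) = 1"
    proof -
      have "s / 2 \<notin> \<int>\<^sub>\<le>\<^sub>0"
        using s by (intro not_nonpos_Int_if_Re_pos) simp
      then have "Gamma (s / 2) \<noteq> 0" by (simp add: Gamma_eq_zero_iff)
      then show ?thesis
        using rGamma_plus1[of "s / 2"] by (simp add: rGamma_inverse_Gamma[of "s / 2"] field_simps)
    qed
    have pi: "complex_of_real pi powr (- s / 2) * of_real pi powr (s / 2) = 1"
      by (simp add: powr_minus)
    have s1: "s - 1 \<noteq> 0" using s by auto
    have cancel: "s * (s - 1) * (1 / 2 * P * G * D) * P' * R / (s - 1) = D"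
      if "s / 2 * G * R = 1" "P * P' = 1" "s - 1 \<noteq> 0" for P G D P' R :: complex
    proof -
      have "s * (s - 1) * (1 / 2 * P * G * D) * P' * R / (s - 1) = (s / 2 * G * R) * (P * P') * D"
        using that(3) by (simp add: field_simps)
      then show ?thesis by (simp only: that mult_1)
    qed
    show ?thesis
      unfolding Z_def xi by (rule cancel[OF gam pi s1])
  qed
  from Zhol Zeq have "\<exists>Z. Z holomorphic_on (- {1}) \<and> (\<forall>s. Re s > 1 \<longrightarrow> Z s = (\<Sum>n. 1 / of_nat (Suc n) powr s))"
    by blast
  from someI_ex[OF this, folded zeta_def]
  have zeta: "zeta holomorphic_on (- {1})"
    "\<And>s. Re s > 1 \<Longrightarrow> zeta s = (\<Sum>n. 1 / of_nat (Suc n) powr s)"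
    by blast+
  show "Re s > 1 \<Longrightarrow> zeta s = (\<Sum>n. 1 / of_nat (Suc n) powr s)"
    by (rule zeta(2))
  show "zeta s = riemann_xi s * of_real pi powr (s / 2) * rGamma (s / 2 + 1) / (s - 1)" if "s \<noteq> 1"
  proof -
    have "zeta s = Z s"
    proof (rule analytic_continuation_open[where f = zeta and g = Z and s = "{s. Re s > 1}" and s' = "- {1}"])
      show "open {s. Re s > 1}" by (rule open_halfspace_Re_gt)
      show "{s. Re s > 1} \<noteq> {}" by (auto intro!: exI[of _ "2::complex"])
      show "connected (- {1::complex})"
        by (rule connected_punctured_universe) simp
    qed (use zeta Zhol Zeq that in auto)
    then show ?thesis by (simp add: Z_def)
  qed
qed

lemma riemann_xi_eq_completed_zeta:
  assumes "s \<noteq> 1" "s / 2 \<notin> \<int>\<^sub>\<le>\<^sub>0"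
  shows "1 / 2 * s * (s - 1) * of_real pi powr (- s / 2) * Gamma (s / 2) * zeta s = riemann_xi s"
proof -
  have gam: "s / 2 * Gamma (s / 2) * rGamma (s / 2 + 1) = 1"
    using assms(2) rGamma_plus1[of "s / 2"]
    by (simp add: rGamma_inverse_Gamma[of "s / 2"] Gamma_eq_zero_iff field_simps)
  have pi: "complex_of_real pi powr (- s / 2) * of_real pi powr (s / 2) = 1"
    by (simp add: powr_minus)
  have "1 / 2 * s * (s - 1) * of_real pi powr (- s / 2) * Gamma (s / 2) * zeta s =
     (s / 2 * Gamma (s / 2) * rGamma (s / 2 + 1)) *
     (complex_of_real pi powr (- s / 2) * of_real pi powr (s / 2)) * ((s - 1) / (s - 1)) * riemann_xi s"
    unfolding zeta_eq_riemann_xi[OF assms(1)] by (simp add: mult_ac)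
  also have "\<dots> = riemann_xi s"
    unfolding gam pi using assms(1) by simp
  finally show ?thesis .
qed

section \<open>Gaussian variance mixtures\<close>

text \<open>
  Under \<open>x \<mapsto> 1 / x\<close> the Jacobian contributes \<open>x powr (-2)\<close> and the symmetry of \<open>g\<close> contributes
  \<open>x powr (3/2)\<close>, so the exponent \<open>a\<close> is reflected to \<open>- a - 1 / 2\<close>. The centre of this
  reflection is \<open>- 1 / 4\<close>, which for \<open>a = (s - 1) / 2\<close> means \<open>s = 1 / 2\<close>.
\<close>

lemma mixing_density_inversion:
  fixes g :: "real \<Rightarrow> real"
  assumes symm: "\<And>x. x > 0 \<Longrightarrow> g x = x powr (- 3 / 2) * g (1 / x)" and x: "x > 0"
  shows "(1 / x\<^sup>2) *\<^sub>R ((1 / x) powr a * g (1 / x)) = x powr (- a - 1 / 2) * g x"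
    and "(1 / x\<^sup>2) *\<^sub>R (complex_of_real (1 / x) powr z * of_real (g (1 / x))) =
           of_real x powr (- z - 1 / 2) * of_real (g x)"
proof -
  have g: "g (1 / x) = x powr (3 / 2) * g x"
    unfolding symm[OF x] using x by (simp add: mult.assoc[symmetric] powr_add[symmetric])
  have x2: "1 / x\<^sup>2 = x powr (- 2)"
    using x by (simp add: powr_minus divide_inverse)
  have inv: "(1 / x) powr b = x powr (- b)" for b
    using x by (simp add: powr_divide powr_minus_divide)
  have "x powr (- 2) * (x powr (- a) * x powr (3 / 2)) = x powr (- a - 1 / 2)"
    unfolding powr_add[symmetric] by (rule arg_cong) simp
  then show "(1 / x\<^sup>2) *\<^sub>R ((1 / x) powr a * g (1 / x)) = x powr (- a - 1 / 2) * g x"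
    unfolding x2 inv g by (simp add: mult_ac)
  have ex: "complex_of_real (x powr b) = exp (of_real b * of_real (ln x))" for b
    using x by (simp add: powr_def exp_of_real[symmetric])
  have inv': "complex_of_real (1 / x) powr z = exp (- z * of_real (ln x))"
    using x by (subst powr_of_pos_real) (simp_all add: ln_div)
  have e: "exp (of_real (- 2) * of_real (ln x)) * (exp (- z * of_real (ln x)) * exp (of_real (3 / 2) * of_real (ln x))) =
     exp ((- z - 1 / 2) * complex_of_real (ln x))"
    unfolding exp_add[symmetric] by (rule arg_cong) (simp add: algebra_simps)
  show "(1 / x\<^sup>2) *\<^sub>R (complex_of_real (1 / x) powr z * of_real (g (1 / x))) =
           of_real x powr (- z - 1 / 2) * of_real (g x)"
    unfolding x2 inv' g powr_of_pos_real[OF x] scaleR_conv_of_real of_real_mult ex e[symmetric]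
    by (simp only: mult.assoc)
qed

lemma mixing_density_measurable:
  assumes "set_integrable lborel {0<..} (g :: real \<Rightarrow> real)"
  shows "(\<lambda>y. indicator {0<..} y * g y) \<in> borel_measurable borel"
  using assms unfolding set_integrable_def by (auto dest: borel_measurable_integrable)

text \<open>
  The moment of order \<open>n\<close> is finite by assumption and the one of order \<open>- n - 1 / 2\<close> by
  inversion. Every real exponent lies between two such, and \<open>x powr a\<close> is at most the sum of two
  powers of \<open>x\<close> whose exponents enclose \<open>a\<close>.
\<close>

lemma mixing_density_powr_integrable:
  fixes g :: "real \<Rightarrow> real"
  assumes symm: "\<And>x. x > 0 \<Longrightarrow> g x = x powr (- 3 / 2) * g (1 / x)"
    and moments: "\<And>n::nat. set_integrable lborel {0<..} (\<lambda>x. x ^ n * g x)"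
  shows "set_integrable lborel {0<..} (\<lambda>x. x powr a * g x)"
proof -
  define n where "n = nat \<lceil>\<bar>a\<bar>\<rceil>"
  have n: "\<bar>a\<bar> \<le> real n" unfolding n_def by linarith
  have m: "(\<lambda>y. indicator {0<..} y * g y) \<in> borel_measurable borel"
    using mixing_density_measurable[of g] moments[of 0] by simp
  have meas: "set_borel_measurable borel {0<..} (\<lambda>x. x powr b * g x)" for b
  proof -
    have "(\<lambda>x. x powr b * (indicator {0<..} x * g x)) \<in> borel_measurable borel"
      using m by measurable
    then show ?thesis by (simp add: set_borel_measurable_def mult.left_commute)
  qed
  have pos: "set_integrable lborel {0<..} (\<lambda>x. x powr real n * g x)"
    using moments[of n] by (subst set_integrable_cong[OF refl refl]) (auto simp: powr_realpow)
  then have "set_integrable lborel {0<..} (\<lambda>x. (1 / x\<^sup>2) *\<^sub>R ((1 / x) powr real n * g (1 / x)))"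
    by (subst lborel_inversion(1)[OF _ _ _ _ meas]) (auto simp: image_inverse_greaterThan)
  also have "?this \<longleftrightarrow> set_integrable lborel {0<..} (\<lambda>x. x powr (- real n - 1 / 2) * g x)"
    using mixing_density_inversion(1)[OF symm] by (intro set_integrable_cong refl) auto
  finally have neg: "set_integrable lborel {0<..} (\<lambda>x. x powr (- real n - 1 / 2) * g x)" .
  have "set_integrable lborel {0<..} (\<lambda>x. x powr real n * g x + x powr (- real n - 1 / 2) * g x)"
    by (intro set_integral_add pos neg)
  then show ?thesis
  proof (rule set_integrable_bound)
    show "set_borel_measurable lborel {0<..} (\<lambda>x. x powr a * g x)"
      using meas by (simp add: set_borel_measurable_def)
    have "x powr a \<le> x powr real n + x powr (- real n - 1 / 2)" if "x > 0" for x
    proof (cases "x \<ge> 1")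
      case True
      then have "x powr a \<le> x powr real n" using n by (intro powr_mono) auto
      then show ?thesis by (simp add: add_increasing2)
    next
      case False
      then have "x powr a \<le> x powr (- real n - 1 / 2)" using n that by (intro powr_mono') auto
      then show ?thesis by (simp add: add_increasing)
    qed
    then have "x powr a * \<bar>g x\<bar> \<le> \<bar>(x powr real n + x powr (- real n - 1 / 2)) * g x\<bar>" if "x > 0" for x
      using that by (auto simp: abs_mult intro!: mult_right_mono)
    then show "AE x in lborel. x \<in> {0<..} \<longrightarrow> norm (x powr a * g x) \<le>
        norm (x powr real n * g x + x powr (- real n - 1 / 2) * g x)"
      by (auto simp: abs_mult distrib_right)
  qed
qed

lemma mixing_density_mellin_symmetric:
  fixes g :: "real \<Rightarrow> real"
  assumes symm: "\<And>x. x > 0 \<Longrightarrow> g x = x powr (- 3 / 2) * g (1 / x)"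
    and g: "set_integrable lborel {0<..} g"
  shows "(LBINT x:{0<..}. complex_of_real x powr (- z - 1 / 2) * of_real (g x)) =
         (LBINT x:{0<..}. complex_of_real x powr z * of_real (g x))"
proof -
  note m = mixing_density_measurable[OF g]
  have "(\<lambda>x. complex_of_real x powr z * of_real (indicator {0<..} x * g x)) \<in> borel_measurable borel"
    using m by measurable
  then have meas: "set_borel_measurable borel {0<..} (\<lambda>x. complex_of_real x powr z * of_real (g x))"
    by (simp add: set_borel_measurable_def scaleR_conv_of_real mult.left_commute)
  have "(LBINT x:{0<..}. complex_of_real x powr (- z - 1 / 2) * of_real (g x)) =
     (LBINT x:{0<..}. (1 / x\<^sup>2) *\<^sub>R (complex_of_real (1 / x) powr z * of_real (g (1 / x))))"
    using mixing_density_inversion(2)[OF symm] by (intro set_lebesgue_integral_cong) auto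
  also have "\<dots> = (LBINT x:{0<..}. complex_of_real x powr z * of_real (g x))"
    by (rule lborel_inversion(2)[OF _ _ _ _ meas]) (auto simp: image_inverse_greaterThan)
  finally show ?thesis .
qed

text \<open>
  Fubini and the Gaussian characteristic function: a mixture of normal densities with variances
  \<open>y\<close> has the corresponding mixture of the functions \<open>exp (- t\<^sup>2 * y / 2)\<close> as Fourier transform.
\<close>

lemma char_fun_variance_mixture:
  assumes g: "set_integrable lborel {0<..} g"
  shows "char_fun (variance_mixture g) t =
           of_real (LBINT y:{0<..}. exp (- (t\<^sup>2 * y / 2)) * g y)"
proof -
  define G where "G = (\<lambda>y. indicator {0<..} y * g y)"
  have [measurable]: "G \<in> borel_measurable borel"
    unfolding G_def by (rule mixing_density_measurable[OF g])
  have Gint: "integrable lborel G"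
    using g by (simp add: G_def set_integrable_def)
  have G0: "G y = 0" if "\<not> y > 0" for y using that by (simp add: G_def)
  define F where "F = (\<lambda>y x. complex_of_real (G y) *
     (exp (\<i> * of_real (t * x)) * complex_of_real (normal_density 0 (sqrt y) x)))"
  have Fm: "case_prod F \<in> borel_measurable (lborel \<Otimes>\<^sub>M lborel)"
    unfolding F_def normal_density_def by measurable
  have E: "integrable lborel (\<lambda>x. exp (\<i> * of_real (t * x)) * complex_of_real (normal_density 0 (sqrt y) x))"
    if "y > 0" for y
  proof (rule Bochner_Integration.integrable_bound[OF integrable_normal_density[of "sqrt y" 0]])
    show "AE x in lborel. norm (exp (\<i> * of_real (t * x)) * complex_of_real (normal_density 0 (sqrt y) x))
         \<le> norm (normal_density 0 (sqrt y) x)"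
      by (auto simp: norm_mult)
  qed (use that in auto)
  have Fint: "integrable lborel (F y)" for y
  proof (cases "y > 0")
    case True
    show ?thesis unfolding F_def by (rule integrable_mult_right[OF E[OF True]])
  qed (simp add: F_def G0)
  have Fnorm: "(LINT x|lborel. norm (F y x)) = \<bar>G y\<bar>" for y
  proof (cases "y > 0")
    case True
    then have "(LINT x|lborel. norm (F y x)) = (LINT x|lborel. \<bar>G y\<bar> * normal_density 0 (sqrt y) x)"
      by (intro Bochner_Integration.integral_cong) (auto simp: F_def norm_mult)
    also have "\<dots> = \<bar>G y\<bar> * (LINT x|lborel. normal_density 0 (sqrt y) x)"
      by (rule integral_mult_right_zero)
    also have "(LINT x|lborel. normal_density 0 (sqrt y) x) = 1"
      using True by (intro integral_normal_density) auto
    finally show ?thesis by simp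
  qed (simp add: F_def G0)
  have Fprod: "integrable (lborel \<Otimes>\<^sub>M lborel) (case_prod F)"
  proof (rule lborel_pair.Fubini_integrable[OF Fm])
    show "integrable lborel (\<lambda>y. LINT x|lborel. norm (case (y, x) of (y, x) \<Rightarrow> F y x))"
      using Gint by (simp add: Fnorm)
  qed (use Fint in auto)
  have inner: "exp (\<i> * of_real (t * x)) * complex_of_real (variance_mixture g x) = (LINT y|lborel. F y x)" for x
  proof -
    have "variance_mixture g x = (LINT y|lborel. G y * normal_density 0 (sqrt y) x)"
      unfolding variance_mixture_def set_lebesgue_integral_def
      by (intro Bochner_Integration.integral_cong)
         (auto simp: G_def normal_density_def split: split_indicator)
    then have "complex_of_real (variance_mixture g x) = (LINT y|lborel. complex_of_real (G y * normal_density 0 (sqrt y) x))"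
      by (simp only: integral_complex_of_real)
    then have "exp (\<i> * of_real (t * x)) * complex_of_real (variance_mixture g x) =
       (LINT y|lborel. exp (\<i> * of_real (t * x)) * complex_of_real (G y * normal_density 0 (sqrt y) x))"
      by (simp only: integral_mult_right_zero)
    also have "\<dots> = (LINT y|lborel. F y x)"
      unfolding F_def by (simp add: mult_ac)
    finally show ?thesis .
  qed
  have "char_fun (variance_mixture g) t = (LINT x|lborel. LINT y|lborel. F y x)"
    unfolding char_fun_def inner ..
  also have "\<dots> = (LINT y|lborel. LINT x|lborel. F y x)"
    by (rule lborel_pair.Fubini_integral[OF Fprod])
  also have "\<dots> = (LINT y|lborel. complex_of_real (indicator {0<..} y *\<^sub>R (exp (- (t\<^sup>2 * y / 2)) * g y)))"
  proof (intro Bochner_Integration.integral_cong refl)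
    fix y :: real
    show "(LINT x|lborel. F y x) = complex_of_real (indicator {0<..} y *\<^sub>R (exp (- (t\<^sup>2 * y / 2)) * g y))"
    proof (cases "y > 0")
      case True
      have "(LINT x|lborel. F y x) = complex_of_real (G y) * of_real (exp (- (y * t\<^sup>2 / 2)))"
        unfolding F_def by (simp only: integral_mult_right_zero gaussian_fourier[OF True])
      then show ?thesis using True by (simp add: G_def mult.commute)
    qed (simp add: F_def G0)
  qed
  finally show ?thesis
    unfolding set_lebesgue_integral_def integral_complex_of_real .
qed

text \<open>
  At \<open>t = sqrt (2 * pi) * x * n\<close> the exponent \<open>- t\<^sup>2 * y / 2\<close> is \<open>- pi * n\<^sup>2 * (sqrt y * x)\<^sup>2\<close>, a
  summand of the theta tail at \<open>sqrt y * x\<close>. The exchange of sum and integral rests on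
  \<open>exp (- u) \<le> 1 / u\<close>, which bounds the \<open>n\<close>-th integral by a multiple of the moment of order
  \<open>-1\<close> divided by \<open>n\<^sup>2\<close>.
\<close>

lemma psi_M_eq_theta_mixture:
  assumes nonneg: "\<And>y. y > 0 \<Longrightarrow> 0 \<le> g y"
    and powr: "\<And>a::real. set_integrable lborel {0<..} (\<lambda>y. y powr a * g y)"
    and x: "x > 0"
  shows "summable (psi_term g x)"
    and "psi_M g x = of_real (LBINT y:{0<..}. theta_tail (sqrt y * x) * g y)"
proof -
  have g: "set_integrable lborel {0<..} g"
    using powr[of 0] by (subst (asm) set_integrable_cong[OF refl refl, of _ _ g]) auto
  define f where "f = (\<lambda>n y. indicator {0<..} y *\<^sub>R (exp (- (pi * (real (Suc n))\<^sup>2 * (sqrt y * x)\<^sup>2)) * g y))"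
  have term_eq: "psi_term g x n = of_real (LINT y|lborel. f n y)" for n
  proof -
    have "psi_term g x n = of_real (LBINT y:{0<..}. exp (- ((sqrt (2 * pi) * x * real (Suc n))\<^sup>2 * y / 2)) * g y)"
      unfolding psi_term_def by (rule char_fun_variance_mixture[OF g])
    also have "(LBINT y:{0<..}. exp (- ((sqrt (2 * pi) * x * real (Suc n))\<^sup>2 * y / 2)) * g y) = (LINT y|lborel. f n y)"
      unfolding set_lebesgue_integral_def f_def
      by (intro Bochner_Integration.integral_cong)
         (auto simp: power_mult_distrib mult_ac split: split_indicator)
    finally show ?thesis .
  qed
  have fm: "f n \<in> borel_measurable lborel" for n
  proof -
    have "(\<lambda>y. exp (- (pi * (real (Suc n))\<^sup>2 * (sqrt y * x)\<^sup>2)) * (indicator {0<..} y * g y)) \<in> borel_measurable borel"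
      using mixing_density_measurable[OF g] by measurable
    then show ?thesis by (simp add: f_def mult.left_commute)
  qed
  define C where "C = (LBINT y:{0<..}. y powr (- 1) * g y)"
  define w where "w = (\<lambda>n y. (1 / (pi * (real (Suc n))\<^sup>2 * x\<^sup>2)) * (indicator {0<..} y *\<^sub>R (y powr (- 1) * g y)))"
  have wint: "integrable lborel (w n)" for n
    using powr[of "-1"] unfolding w_def set_integrable_def by (rule integrable_mult_right)
  have wval: "(LINT y|lborel. w n y) = (1 / (pi * (real (Suc n))\<^sup>2 * x\<^sup>2)) * C" for n
    unfolding w_def C_def set_lebesgue_integral_def by (rule integral_mult_right_zero)
  have fw: "norm (f n y) \<le> w n y" for n y
  proof (cases "y > 0")
    case True
    define u where "u = pi * (real (Suc n))\<^sup>2 * (sqrt y * x)\<^sup>2"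
    have u: "u > 0" using True x by (simp add: u_def)
    have "u \<le> exp u" using exp_ge_add_one_self[of u] by linarith
    then have "exp (- u) \<le> 1 / u" using u by (simp add: exp_minus field_simps)
    also have "1 / u = (1 / (pi * (real (Suc n))\<^sup>2 * x\<^sup>2)) * y powr (- 1)"
      using True by (simp add: u_def power_mult_distrib powr_minus divide_inverse mult_ac)
    finally have "exp (- u) * g y \<le> (1 / (pi * (real (Suc n))\<^sup>2 * x\<^sup>2)) * y powr (- 1) * g y"
      using nonneg[OF True] by (rule mult_right_mono)
    moreover have "norm (f n y) = exp (- u) * g y"
      using True nonneg[OF True] by (simp add: f_def u_def abs_mult)
    moreover have "w n y = (1 / (pi * (real (Suc n))\<^sup>2 * x\<^sup>2)) * y powr (- 1) * g y"
      using True by (simp add: w_def)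
    ultimately show ?thesis by simp
  qed (simp add: f_def w_def)
  have fint: "integrable lborel (f n)" for n
  proof (rule Bochner_Integration.integrable_bound[OF wint[of n] fm])
    show "AE y in lborel. norm (f n y) \<le> norm (w n y)"
      using order_trans[OF fw abs_ge_self] by auto
  qed
  have fsum: "summable (\<lambda>n. LINT y|lborel. norm (f n y))"
  proof (rule summable_comparison_test')
    have "summable (\<lambda>n. 1 / (real (Suc n))\<^sup>2)"
      using inverse_power_summable[of 2, where 'a = real]
      by (subst summable_Suc_iff) (simp add: divide_inverse)
    then have "summable (\<lambda>n. (C / (pi * x\<^sup>2)) * (1 / (real (Suc n))\<^sup>2))"
      by (rule summable_mult)
    then show "summable (\<lambda>n. (1 / (pi * (real (Suc n))\<^sup>2 * x\<^sup>2)) * C)"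
      by (simp add: mult_ac)
    show "norm (LINT y|lborel. norm (f n y)) \<le> (1 / (pi * (real (Suc n))\<^sup>2 * x\<^sup>2)) * C" for n
      unfolding wval[symmetric]
      using integral_mono[OF integrable_norm[OF fint] wint fw] by simp
  qed
  have sums: "(\<lambda>n. f n y) sums (indicator {0<..} y *\<^sub>R (theta_tail (sqrt y * x) * g y))" for y
  proof (cases "y > 0")
    case True
    then have "(\<lambda>n. exp (- (pi * (real (Suc n))\<^sup>2 * (sqrt y * x)\<^sup>2))) sums theta_tail (sqrt y * x)"
      unfolding theta_tail_def using x by (intro summable_sums summable_theta_tail) simp
    then show ?thesis using True by (simp add: f_def sums_mult2)
  qed (simp add: f_def)
  have "f n y \<ge> 0" for n y using nonneg by (simp add: f_def indicator_def)
  then have "norm (f n y) = f n y" for n y by simp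
  then have AE: "AE y in lborel. summable (\<lambda>n. norm (f n y))"
    using sums by (auto simp: sums_iff)
  note L = fint AE fsum
  show "summable (psi_term g x)"
    unfolding term_eq[abs_def] using summable_integral[OF L] by (simp only: summable_complex_of_real)
  have "(\<Sum>n. f n y) = indicator {0<..} y *\<^sub>R (theta_tail (sqrt y * x) * g y)" for y
    using sums by (simp add: sums_iff)
  then have "(\<Sum>n. LINT y|lborel. f n y) = (LBINT y:{0<..}. theta_tail (sqrt y * x) * g y)"
    using integral_suminf[OF L] by (simp add: set_lebesgue_integral_def)
  moreover have "(\<lambda>n. complex_of_real (LINT y|lborel. f n y)) sums of_real (\<Sum>n. LINT y|lborel. f n y)"
    using summable_sums[OF summable_integral[OF L]] by (rule sums_of_real)
  ultimately show "psi_M g x = of_real (LBINT y:{0<..}. theta_tail (sqrt y * x) * g y)"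
    unfolding psi_M_def term_eq[abs_def] by (simp add: sums_iff)
qed

text \<open>
  By Fubini the Mellin transform of the mixture is the mixture of the Mellin transforms of
  \<open>x \<mapsto> theta_tail (sqrt y * x)\<close>, and scaling by \<open>sqrt y\<close> multiplies a Mellin transform by
  \<open>y powr (- s / 2)\<close>. Absolute convergence is the same computation with \<open>Re s\<close> in place of \<open>s\<close>.
\<close>

theorem mellin_psi_M:
  assumes nonneg: "\<And>y. y > 0 \<Longrightarrow> 0 \<le> g y"
    and powr: "\<And>a::real. set_integrable lborel {0<..} (\<lambda>y. y powr a * g y)"
    and s: "Re s > 1"
  shows "mellin_integrable (psi_M g) s"
    and "mellin (psi_M g) s =
           1 / 2 * of_real pi powr (- s / 2) * Gamma (s / 2) * zeta s *
             (LBINT y:{0<..}. complex_of_real y powr (- s / 2) * of_real (g y))"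
proof -
  have g: "set_integrable lborel {0<..} g"
    using powr[of 0] by (subst (asm) set_integrable_cong[OF refl refl, of _ _ g]) auto
  define K where "K = (\<lambda>z. 1 / 2 * of_real pi powr (- z / 2) * Gamma (z / 2) * (\<Sum>n. 1 / complex_of_nat (Suc n) powr z))"
  define T where "T = (\<lambda>z r x. indicator {0<..} x *\<^sub>R (complex_of_real x powr (z - 1) * of_real (theta_tail (r * x))))"
  have Tint: "integrable lborel (T z r)" and Tval: "(LINT x|lborel. T z r x) = of_real r powr (- z) * K z"
    if "r > 0" "Re z > 1" for z r
    using theta_tail_mellin[OF that] by (simp_all add: T_def K_def set_integrable_def set_lebesgue_integral_def)
  have sqrt_powr: "complex_of_real (sqrt y) powr (- z) = of_real y powr (- z / 2)" if "y > 0" for y z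
    using that by (simp add: powr_of_pos_real ln_sqrt)
  define G where "G = (\<lambda>y. indicator {0<..} y * g y)"
  have [measurable]: "G \<in> borel_measurable borel"
    unfolding G_def by (rule mixing_density_measurable[OF g])
  have G0: "G y = 0" if "\<not> y > 0" for y using that by (simp add: G_def)
  define F where "F = (\<lambda>y x. complex_of_real (G y) * T s (sqrt y) x)"
  have Fm: "case_prod F \<in> borel_measurable (lborel \<Otimes>\<^sub>M lborel)"
    unfolding F_def T_def by measurable
  have Fint: "integrable lborel (F y)" for y
    by (cases "y > 0") (auto simp: F_def G0 s intro!: integrable_mult_right Tint)
  have normT: "complex_of_real (norm (T s r x)) = T (of_real (Re s)) r x" if r: "r > 0" for r x
  proof (cases "x > 0")
    case True
    then have "complex_of_real x powr (of_real (Re s) - 1) = of_real (x powr (Re s - 1))"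
      using powr_of_real[of x "Re s - 1"] by simp
    then show ?thesis using True r theta_tail_nonneg[of "r * x"]
      by (simp add: T_def norm_mult norm_powr_real_powr)
  qed (simp add: T_def)
  have Fnorm: "(LINT x|lborel. norm (F y x)) = norm (K (of_real (Re s))) * (indicator {0<..} y *\<^sub>R (y powr (- Re s / 2) * g y))" for y
  proof (cases "y > 0")
    case True
    have "complex_of_real (LINT x|lborel. norm (T s (sqrt y) x)) = of_real y powr (- of_real (Re s) / 2) * K (of_real (Re s))"
      using True s unfolding integral_complex_of_real[symmetric]
      by (simp add: normT Tval sqrt_powr)
    from arg_cong[OF this, of norm]
    have "\<bar>LINT x|lborel. norm (T s (sqrt y) x)\<bar> = y powr (- Re s / 2) * norm (K (of_real (Re s)))"
      using True unfolding norm_of_real by (simp add: norm_mult norm_powr_real_powr)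
    moreover have "(LINT x|lborel. norm (T s (sqrt y) x)) \<ge> 0" by simp
    ultimately have "(LINT x|lborel. norm (T s (sqrt y) x)) = y powr (- Re s / 2) * norm (K (of_real (Re s)))"
      by linarith
    then show ?thesis
      using True nonneg[OF True] by (simp add: F_def G_def norm_mult)
  qed (simp add: F_def G0)
  have Fprod: "integrable (lborel \<Otimes>\<^sub>M lborel) (case_prod F)"
  proof (rule lborel_pair.Fubini_integrable[OF Fm])
    show "integrable lborel (\<lambda>y. LINT x|lborel. norm (case (y, x) of (y, x) \<Rightarrow> F y x))"
      using powr[of "- Re s / 2"] by (simp add: Fnorm set_integrable_def)
  qed (use Fint in auto)
  have inner: "indicator {0<..} x *\<^sub>R (complex_of_real x powr (s - 1) * psi_M g x) = (LINT y|lborel. F y x)" for x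
  proof (cases "x > 0")
    case True
    have "psi_M g x = (LINT y|lborel. complex_of_real (theta_tail (sqrt y * x) * G y))"
    proof -
      have "psi_M g x = of_real (LINT y|lborel. theta_tail (sqrt y * x) * G y)"
        using psi_M_eq_theta_mixture(2)[of g x, OF nonneg powr True]
        unfolding set_lebesgue_integral_def G_def by (simp add: mult.left_commute)
      then show ?thesis by (simp only: integral_complex_of_real)
    qed
    then have "complex_of_real x powr (s - 1) * psi_M g x =
       (LINT y|lborel. complex_of_real x powr (s - 1) * complex_of_real (theta_tail (sqrt y * x) * G y))"
      by (simp only: integral_mult_right_zero)
    then show ?thesis using True by (simp add: F_def T_def mult_ac)
  qed (simp add: F_def T_def)
  show "mellin_integrable (psi_M g) s"
    unfolding mellin_integrable_def set_integrable_def inner by (rule lborel_pair.integrable_snd[OF Fprod])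
  have "mellin (psi_M g) s = (LINT x|lborel. LINT y|lborel. F y x)"
    unfolding mellin_def set_lebesgue_integral_def inner ..
  also have "\<dots> = (LINT y|lborel. LINT x|lborel. F y x)"
    by (rule lborel_pair.Fubini_integral[OF Fprod])
  also have "\<dots> = (LINT y|lborel. K s * (indicator {0<..} y *\<^sub>R (complex_of_real y powr (- s / 2) * of_real (g y))))"
  proof (intro Bochner_Integration.integral_cong refl)
    fix y :: real
    show "(LINT x|lborel. F y x) = K s * (indicator {0<..} y *\<^sub>R (complex_of_real y powr (- s / 2) * of_real (g y)))"
    proof (cases "y > 0")
      case True
      then have "(LINT x|lborel. F y x) = complex_of_real (G y) * (of_real y powr (- s / 2) * K s)"
        using s by (simp add: F_def Tval sqrt_powr)
      then show ?thesis using True by (simp add: G_def)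
    qed (simp add: F_def G0)
  qed
  also have "\<dots> = K s * (LBINT y:{0<..}. complex_of_real y powr (- s / 2) * of_real (g y))"
    unfolding set_lebesgue_integral_def by (rule integral_mult_right_zero)
  finally show "mellin (psi_M g) s = 1 / 2 * of_real pi powr (- s / 2) * Gamma (s / 2) * zeta s *
             (LBINT y:{0<..}. complex_of_real y powr (- s / 2) * of_real (g y))"
    unfolding K_def zeta_eq_Dirichlet_series[OF s] .
qed

section \<open>Factorization of the Mellin transform\<close>

text \<open>
  The Mellin transform comes with the moment of order \<open>- s / 2\<close>; the symmetry of \<open>g\<close> reflects that
  exponent to \<open>(s - 1) / 2\<close>. The witnesses for the three entire functions are \<open>riemann_xi\<close>, the
  moment function of \<open>g\<close> and their product.
\<close>

theorem theorem2:
  fixes g :: "real \<Rightarrow> real"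
  assumes pdf: "pdf_on_pos g"
    and symm: "\<And>x. x > 0 \<Longrightarrow> g x = x powr (- 3 / 2) * g (1 / x)"
    and moments: "\<And>n::nat. set_integrable lborel {0<..} (\<lambda>x. x ^ n * g x)"
  shows "(\<forall>x>0. summable (psi_term g x)) \<and>
    (\<forall>s::complex. Re s > 1 \<longrightarrow>
       mellin_integrable (psi_M g) s \<and>
       set_integrable lborel {0<..} (\<lambda>x. complex_of_real x powr ((s - 1) / 2) * complex_of_real (g x)) \<and>
       mellin (psi_M g) s =
         1 / 2 * complex_of_real pi powr (- s / 2) * Gamma (s / 2) * zeta s *
         (LBINT x:{0<..}. complex_of_real x powr ((s - 1) / 2) * complex_of_real (g x))) \<and>
    (\<exists>\<xi>\<^sub>0 \<xi>\<^sub>1 \<xi>\<^sub>2 :: complex \<Rightarrow> complex.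
       entire_extension {s. s \<noteq> 1 \<and> s / 2 \<notin> \<int>\<^sub>\<le>\<^sub>0}
         (\<lambda>s. 1 / 2 * s * (s - 1) * complex_of_real pi powr (- s / 2) * Gamma (s / 2) * zeta s) \<xi>\<^sub>0 \<and>
       entire_extension {s. Re s > 1}
         (\<lambda>s. LBINT x:{0<..}. complex_of_real x powr ((s - 1) / 2) * complex_of_real (g x)) \<xi>\<^sub>1 \<and>
       entire_extension {s. Re s > 1}
         (\<lambda>s. s * (s - 1) * mellin (psi_M g) s) \<xi>\<^sub>2 \<and>
       (\<forall>s. \<xi>\<^sub>2 s = \<xi>\<^sub>0 s * \<xi>\<^sub>1 s) \<and>
       (\<forall>s. \<xi>\<^sub>0 s = \<xi>\<^sub>0 (1 - s)) \<and>
       (\<forall>s. \<xi>\<^sub>1 s = \<xi>\<^sub>1 (1 - s)) \<and>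
       (\<forall>s. \<xi>\<^sub>2 s = \<xi>\<^sub>2 (1 - s)))"
proof -
  have nonneg: "\<And>y. y > 0 \<Longrightarrow> 0 \<le> g y" and g: "set_integrable lborel {0<..} g"
    using pdf by (auto simp: pdf_on_pos_def)
  have powr: "\<And>a::real. set_integrable lborel {0<..} (\<lambda>y. y powr a * g y)"
    by (rule mixing_density_powr_integrable[OF symm moments])
  define \<xi>\<^sub>1 where "\<xi>\<^sub>1 = (\<lambda>s. LBINT x:{0<..}. complex_of_real x powr ((s - 1) / 2) * complex_of_real (g x))"
  have \<xi>\<^sub>1_flip: "(LBINT x:{0<..}. complex_of_real x powr (- s / 2) * complex_of_real (g x)) = \<xi>\<^sub>1 s" for s
  proof -
    have "- ((s - 1) / 2) - 1 / 2 = - s / 2" by (simp add: field_simps)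
    then show ?thesis
      using mixing_density_mellin_symmetric[OF symm g, of "(s - 1) / 2"] by (simp add: \<xi>\<^sub>1_def)
  qed
  have \<xi>\<^sub>1_sym: "\<xi>\<^sub>1 (1 - s) = \<xi>\<^sub>1 s" for s
    using \<xi>\<^sub>1_flip[of s] by (simp add: \<xi>\<^sub>1_def)
  have \<xi>\<^sub>1_entire: "\<xi>\<^sub>1 holomorphic_on UNIV"
  proof -
    have "(\<lambda>s::complex. (s - 1) / 2) holomorphic_on UNIV"
      by (intro holomorphic_intros) auto
    from holomorphic_on_compose_gen[OF this holomorphic_power_integral[OF _ _ powr]]
    show ?thesis by (simp add: \<xi>\<^sub>1_def o_def)
  qed
  have mellin: "mellin (psi_M g) s =
      1 / 2 * complex_of_real pi powr (- s / 2) * Gamma (s / 2) * zeta s * \<xi>\<^sub>1 s" if "Re s > 1" for s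
    using mellin_psi_M(2)[OF nonneg powr that] unfolding \<xi>\<^sub>1_flip .
  have \<xi>\<^sub>2: "s * (s - 1) * mellin (psi_M g) s = riemann_xi s * \<xi>\<^sub>1 s" if s: "Re s > 1" for s
  proof -
    have "s / 2 \<notin> \<int>\<^sub>\<le>\<^sub>0"
      using s by (intro not_nonpos_Int_if_Re_pos) simp
    moreover have "s \<noteq> 1" using s by auto
    ultimately have "riemann_xi s = 1 / 2 * s * (s - 1) * of_real pi powr (- s / 2) * Gamma (s / 2) * zeta s"
      by (intro riemann_xi_eq_completed_zeta[symmetric])
    then show ?thesis unfolding mellin[OF s] by (simp add: mult_ac)
  qed
  show ?thesis
  proof (intro conjI allI impI exI)
    show "summable (psi_term g x)" if "x > 0" for x
      by (rule psi_M_eq_theta_mixture(1)[OF nonneg powr that])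
    show "mellin_integrable (psi_M g) s" if "Re s > 1" for s
      by (rule mellin_psi_M(1)[OF nonneg powr that])
    show "set_integrable lborel {0<..} (\<lambda>x. complex_of_real x powr ((s - 1) / 2) * complex_of_real (g x))" for s
      by (rule set_integrable_powr_complex[OF _ _ powr]) auto
    show "mellin (psi_M g) s = 1 / 2 * complex_of_real pi powr (- s / 2) * Gamma (s / 2) * zeta s *
         (LBINT x:{0<..}. complex_of_real x powr ((s - 1) / 2) * complex_of_real (g x))" if "Re s > 1" for s
      using mellin[OF that] by (simp add: \<xi>\<^sub>1_def)
    show "entire_extension {s. s \<noteq> 1 \<and> s / 2 \<notin> \<int>\<^sub>\<le>\<^sub>0}
         (\<lambda>s. 1 / 2 * s * (s - 1) * complex_of_real pi powr (- s / 2) * Gamma (s / 2) * zeta s) riemann_xi"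
      using riemann_xi_entire riemann_xi_eq_completed_zeta by (simp add: entire_extension_def)
    show "entire_extension {s. Re s > 1}
         (\<lambda>s. LBINT x:{0<..}. complex_of_real x powr ((s - 1) / 2) * complex_of_real (g x)) \<xi>\<^sub>1"
      using \<xi>\<^sub>1_entire by (simp add: entire_extension_def \<xi>\<^sub>1_def)
    show "entire_extension {s. Re s > 1} (\<lambda>s. s * (s - 1) * mellin (psi_M g) s) (\<lambda>s. riemann_xi s * \<xi>\<^sub>1 s)"
      using \<xi>\<^sub>1_entire riemann_xi_entire \<xi>\<^sub>2 by (auto simp: entire_extension_def intro!: holomorphic_intros)
  qed (simp_all add: riemann_xi_symmetric \<xi>\<^sub>1_sym)
qed

end
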